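(* Let $m\ge 2$ and $\ell\ge 1$ be integers, and let $F_m$ be the free group with free basis $X=\{x_1,\dots,x_m\}$. (1) If $N$ is a nontrivial $\ell$-subnormal subgroup of $F_m$, then the exponential growth rate $\alpha_N$ of $N$ with respect to $X$ is greater than $(2m-1)^{2^{-\ell}}$. (2) For any $\varepsilon>0$ there is a nontrivial $\ell$-subnormal subgroup $N$ of $F_m$ with $\alpha_N<(2m-1)^{2^{-\ell}}+\varepsilon$.
   Context: A subgroup $N$ of a group $G$ is called $\ell$-subnormal in $G$ ($\ell=1,2,\dots$) if there is a decreasing sequence $G\triangleright N_1\triangleright\dots\triangleright N_{\ell}=N$ in which each term is a normal subgroup of the preceding one (not necessarily proper). For a subgroup $N\le F_m$, the growth function is $g_N(n)=\#\{g\in N: |g|\le n\}$, where $|g|$ is the length of $g$ with respect to the free basis $X$, and the exponential growth rate is $\alpha_N=\lim_{n\to\infty}\sqrt[n]{g_N(n)}$ (this limit exists for every subgroup of $F_m$). *)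

theory Defs
  imports Complex_Main "HOL-Algebra.Coset"
begin

text \<open>
  The free group with free basis \<open>X\<close>, realised on the reduced words over \<open>X \<times> {True, False}\<close>:
  the letter \<open>(x, True)\<close> stands for the basis element \<open>x\<close>, and \<open>(x, False)\<close> for its inverse.
\<close>

type_synonym 'a letter = "'a \<times> bool"

definition inv_letter :: "'a letter \<Rightarrow> 'a letter" where
  "inv_letter a = (fst a, \<not> snd a)"

definition reduced :: "'a letter list \<Rightarrow> bool" where
  "reduced w \<longleftrightarrow> successively (\<lambda>a b. b \<noteq> inv_letter a) w"

fun push_letter :: "'a letter \<Rightarrow> 'a letter list \<Rightarrow> 'a letter list" where
  "push_letter a [] = [a]"
| "push_letter a (b # w) = (if b = inv_letter a then w else a # b # w)"

definition reduce :: "'a letter list \<Rightarrow> 'a letter list" where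
  "reduce w = foldr push_letter w []"

definition free_group :: "'a set \<Rightarrow> 'a letter list monoid" where
  "free_group X =
     \<lparr>carrier = {w. reduced w \<and> fst ` set w \<subseteq> X},
      mult = (\<lambda>u v. reduce (u @ v)),
      one = []\<rparr>"

definition l_subnormal :: "nat \<Rightarrow> 'g set \<Rightarrow> ('g, 'b) monoid_scheme \<Rightarrow> bool" where
  "l_subnormal l N G \<longleftrightarrow>
     (\<exists>S. S 0 = carrier G \<and> S l = N \<and> (\<forall>i<l. S (Suc i) \<lhd> (G\<lparr>carrier := S i\<rparr>)))"

text \<open>
  The length of an element of the free group with respect to the free basis is the length of
  the reduced word representing it, that is, the length of the element as a list.
\<close>

definition growth_fun :: "'a letter list set \<Rightarrow> nat \<Rightarrow> nat" where
  "growth_fun N n = card {g \<in> N. length g \<le> n}"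

definition growth_rate :: "'a letter list set \<Rightarrow> real" where
  "growth_rate N = lim (\<lambda>n. root n (real (growth_fun N n)))"


text \<open>The definition above does give a group, and this group is free on \<open>X\<close>.\<close>

lemma inv_letter_simps [simp]:
  "inv_letter (inv_letter a) = a" "fst (inv_letter a) = fst a" "inv_letter a \<noteq> a"
  "a \<noteq> inv_letter a" "inv_letter (x, b) = (x, \<not> b)"
  by (auto simp: inv_letter_def prod_eq_iff)

lemma reduced_simps [simp]:
  "reduced []" "reduced [a]"
  "reduced (a # b # w) \<longleftrightarrow> b \<noteq> inv_letter a \<and> reduced (b # w)"
  by (auto simp: reduced_def)

lemma reduced_ConsD: "reduced (a # w) \<Longrightarrow> reduced w"
  by (cases w) auto

lemma reduced_push: "reduced w \<Longrightarrow> reduced (push_letter a w)"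
  by (cases w) (auto dest: reduced_ConsD)

lemma push_push_inv:
  "reduced w \<Longrightarrow> push_letter a (push_letter (inv_letter a) w) = w"
proof (cases w)
  case (Cons b v)
  then show "reduced w \<Longrightarrow> ?thesis" by (cases v) auto
qed auto

lemma reduced_foldr_push: "reduced w \<Longrightarrow> reduced (foldr push_letter u w)"
  by (induction u) (auto intro: reduced_push)

lemma reduced_reduce: "reduced (reduce w)"
  by (simp add: reduce_def reduced_foldr_push)

lemma reduce_reduced: "reduced w \<Longrightarrow> reduce w = w"
proof (induction w)
  case (Cons a w)
  then show ?case by (cases w) (auto simp: reduce_def)
qed (simp add: reduce_def)

lemma foldr_push_push:
  "reduced w \<Longrightarrow> foldr push_letter (push_letter a u) w = push_letter a (foldr push_letter u w)"
proof (cases u)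
  case (Cons b v)
  then show "reduced w \<Longrightarrow> ?thesis"
    using push_push_inv[of "foldr push_letter v w" a] by (auto simp: reduced_foldr_push)
qed auto

lemma foldr_push_reduce:
  "reduced w \<Longrightarrow> foldr push_letter (reduce u) w = foldr push_letter u w"
  by (induction u) (auto simp: reduce_def foldr_push_push)

lemma reduce_reduce_left: "reduce (reduce u @ v) = reduce (u @ v)"
  using foldr_push_reduce[OF reduced_reduce, of u v] by (simp add: reduce_def)

lemma reduce_reduce_right: "reduce (u @ reduce v) = reduce (u @ v)"
  using reduce_reduced[OF reduced_reduce, of v] by (simp add: reduce_def)

lemma set_push: "set (push_letter a w) \<subseteq> insert a (set w)"
  by (cases w) auto

lemma set_reduce: "set (reduce w) \<subseteq> set w"
proof (induction w)
  case (Cons a w)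
  then show ?case using set_push[of a "reduce w"] by (auto simp: reduce_def)
qed (simp add: reduce_def)

lemma reduce_inverse: "reduce (rev (map inv_letter w) @ w) = []"
proof (induction w)
  case (Cons a w)
  have "push_letter (inv_letter a) (push_letter a (reduce w)) = reduce w"
    using push_push_inv[OF reduced_reduce, of "inv_letter a" w] by simp
  with Cons show ?case by (simp add: reduce_def)
qed (simp add: reduce_def)

lemma group_free_group: "group (free_group X)"
proof (rule groupI)
  fix u assume u: "u \<in> carrier (free_group X)"
  let ?v = "reduce (rev (map inv_letter u))"
  have "?v \<in> carrier (free_group X)"
    using u set_reduce[of "rev (map inv_letter u)"]
    by (force simp: free_group_def reduced_reduce)
  moreover have "?v \<otimes>\<^bsub>free_group X\<^esub> u = \<one>\<^bsub>free_group X\<^esub>"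
    by (simp add: free_group_def reduce_reduce_left reduce_inverse)
  ultimately show "\<exists>v\<in>carrier (free_group X). v \<otimes>\<^bsub>free_group X\<^esub> u = \<one>\<^bsub>free_group X\<^esub>"
    by blast
next
  fix u v assume "u \<in> carrier (free_group X)" "v \<in> carrier (free_group X)"
  then show "u \<otimes>\<^bsub>free_group X\<^esub> v \<in> carrier (free_group X)"
    using set_reduce[of "u @ v"] by (fastforce simp: free_group_def reduced_reduce)
qed (auto simp: free_group_def reduce_reduced reduce_reduce_left reduce_reduce_right)

definition word_eval :: "('h, 'b) monoid_scheme \<Rightarrow> ('a \<Rightarrow> 'h) \<Rightarrow> 'a letter list \<Rightarrow> 'h" where
  "word_eval H f w =
     foldr (\<lambda>a h. (if snd a then f (fst a) else inv\<^bsub>H\<^esub> f (fst a)) \<otimes>\<^bsub>H\<^esub> h) w \<one>\<^bsub>H\<^esub>"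

lemma free_group_universal:
  assumes "group H" and f: "f \<in> X \<rightarrow> carrier H"
  shows "\<exists>h\<in>hom (free_group X) H. \<forall>x\<in>X. h [(x, True)] = f x"
proof -
  interpret H: group H by fact
  let ?W = "\<lambda>w. fst ` set w \<subseteq> X"
  have closed: "word_eval H f w \<in> carrier H" if "?W w" for w
    using that f by (induction w) (auto simp: word_eval_def)
  have push: "word_eval H f (push_letter a w) = word_eval H f (a # w)" if "?W (a # w)" for a w
  proof (cases w)
    case (Cons b v)
    have "f (fst a) \<in> carrier H" "word_eval H f v \<in> carrier H"
      using that f Cons closed[of v] by auto
    then show ?thesis
      unfolding Cons by (auto simp: word_eval_def inv_letter_def H.m_assoc[symmetric])
  qed auto
  have red: "word_eval H f (reduce w) = word_eval H f w" if "?W w" for w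
    using that
  proof (induction w)
    case (Cons a w)
    then have "?W (a # reduce w)" using set_reduce[of w] by auto
    from push[OF this] Cons show ?case by (simp add: reduce_def word_eval_def)
  qed (simp add: reduce_def)
  have app: "word_eval H f (u @ v) = word_eval H f u \<otimes>\<^bsub>H\<^esub> word_eval H f v"
    if "?W u" "?W v" for u v
    using that
  proof (induction u)
    case Nil
    then show ?case using closed[of v] by (simp add: word_eval_def)
  next
    case (Cons a u)
    then have "f (fst a) \<in> carrier H" "word_eval H f u \<in> carrier H" "word_eval H f v \<in> carrier H"
      using closed f by auto
    with Cons show ?case by (simp add: word_eval_def H.m_assoc)
  qed
  have "word_eval H f \<in> hom (free_group X) H"
    by (rule homI) (auto simp: free_group_def closed red app image_Un)
  moreover have "\<forall>x\<in>X. word_eval H f [(x, True)] = f x"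
    using f by (simp add: word_eval_def Pi_iff)
  ultimately show ?thesis by blast
qed

lemma free_group_hom_unique:
  assumes "group H" and h: "h \<in> hom (free_group X) H" and k: "k \<in> hom (free_group X) H"
    and eq: "\<forall>x\<in>X. h [(x, True)] = k [(x, True)]"
    and w: "w \<in> carrier (free_group X)"
  shows "h w = k w"
proof -
  interpret H: group H by fact
  interpret F: group "free_group X" by (rule group_free_group)
  interpret h: group_hom "free_group X" H h by unfold_locales fact
  interpret k: group_hom "free_group X" H k by unfold_locales fact
  have letter: "h [a] = k [a]" if a: "fst a \<in> X" for a
  proof (cases "snd a")
    case True
    with a eq show ?thesis by (cases a) auto
  next
    case False
    let ?x = "[(fst a, True)]"
    have mem: "?x \<in> carrier (free_group X)" "[a] \<in> carrier (free_group X)"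
      using a by (auto simp: free_group_def)
    have "[a] \<otimes>\<^bsub>free_group X\<^esub> ?x = \<one>\<^bsub>free_group X\<^esub>"
      using False by (cases a) (simp add: free_group_def reduce_def)
    then have "[a] = inv\<^bsub>free_group X\<^esub> ?x"
      using mem by (metis F.inv_equality)
    then show ?thesis using a eq mem by simp
  qed
  show ?thesis using w
  proof (induction w)
    case Nil
    have "[] = \<one>\<^bsub>free_group X\<^esub>" by (simp add: free_group_def)
    then show ?case by (metis h.hom_one k.hom_one)
  next
    case (Cons a w)
    then have mem: "[a] \<in> carrier (free_group X)" "w \<in> carrier (free_group X)"
      by (auto simp: free_group_def dest: reduced_ConsD)
    have "a # w = [a] \<otimes>\<^bsub>free_group X\<^esub> w"
      using Cons.prems by (simp add: free_group_def reduce_reduced)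
    moreover have "h [a] = k [a]" using letter Cons.prems by (simp add: free_group_def)
    ultimately show ?case
      using h.hom_mult[OF mem] k.hom_mult[OF mem] Cons.IH[OF mem(2)] by simp
  qed
qed

end

theory Submission
  imports Defs "HOL-Real_Asymp.Real_Asymp"
begin

text \<open>
  Lower bound. A nontrivial subnormal subgroup contains, for any two letters \<open>a\<close>, \<open>b\<close>, a reduced
  word that starts with \<open>a\<close> and ends with \<open>b\<close>. Inserting such words avoids cancellation in
  products and conjugates. Hence the growth function is supermultiplicative up to polynomial
  factors, so the limit defining the growth rate exists, and \<open>N \<lhd> M\<close> gives
  \<open>\<alpha>\<^sub>M \<le> \<alpha>\<^sub>N\<^sup>2\<close>. For \<open>N\<close> normal in the free group, conjugating words and products of two words by
  letters gives a recursion \<open>d (n + 2 r + 2) \<ge> q d (n + 2 r) + d n\<close> with \<open>q = 2 m - 1\<close>, and so the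
  strict inequality \<open>\<alpha>\<^sub>N > sqrt q\<close>, which is then propagated down the chain.

  Upper bound. Given \<open>M\<close> with \<open>x\<^sup>R \<in> M\<close>, wind up the lines \<open>\<langle>x\<rangle> t\<close>, \<open>t \<in> M\<close>, of the Cayley tree to
  cycles of length \<open>R\<close> and unfold the rest, to get a tree of such cycles (a cactus). The free group acts
  on its vertices, and the elements of \<open>M\<close> that fix every vertex reached by a word of \<open>M\<close> form a
  normal subgroup \<open>N\<close> of \<open>M\<close> with \<open>x\<^sup>R \<in> N\<close>. A closed path in the cactus traverses each edge off the
  cycles equally often in both directions, so for large \<open>R\<close> only about half of its steps are free,
  which makes \<open>\<alpha>\<^sub>N\<close> close to \<open>sqrt \<alpha>\<^sub>M\<close>. The bookkeeping is done by bounded positive functions on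
  directed edges that are superharmonic for the non-backtracking walk: one for \<open>M\<close> with factor
  \<open>\<beta>\<close> yields one for \<open>N\<close> with factor close to \<open>sqrt \<beta>\<close>.
\<close>

section \<open>Reduced words and the free group on a finite set\<close>

lemma reduced_append_iff:
  "reduced (u @ v) \<longleftrightarrow> reduced u \<and> reduced v \<and> (u \<noteq> [] \<longrightarrow> v \<noteq> [] \<longrightarrow> hd v \<noteq> inv_letter (last u))"
  unfolding reduced_def successively_append_iff by auto

lemma reduced_Cons_iff:
  "reduced (a # w) \<longleftrightarrow> reduced w \<and> (w \<noteq> [] \<longrightarrow> hd w \<noteq> inv_letter a)"
  by (cases w) auto

lemma inv_letter_eq_iff: "inv_letter a = b \<longleftrightarrow> a = inv_letter b"
  by auto

lemma reduced_inverse: "reduced w \<Longrightarrow> reduced (rev (map inv_letter w))"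
  by (induction w) (auto simp: reduced_Cons_iff reduced_append_iff last_rev hd_map)

lemma push_letter_reduced: "reduced (a # w) \<Longrightarrow> push_letter a w = a # w"
  by (cases w) auto

locale finite_basis =
  fixes X :: "'a set"
  assumes finite_X: "finite X"
begin

abbreviation F :: "'a letter list monoid" where "F \<equiv> free_group X"

definition letters :: "'a letter set" where "letters = X \<times> UNIV"

sublocale F: group F
  by (rule group_free_group)

lemma finite_letters: "finite letters"
  using finite_X by (simp add: letters_def)

lemma card_letters: "card letters = 2 * card X"
  by (simp add: letters_def card_cartesian_product)

lemma inv_letter_mem [simp]: "inv_letter a \<in> letters \<longleftrightarrow> a \<in> letters"
  by (cases a) (auto simp: letters_def)

lemma carrier_iff: "g \<in> carrier F \<longleftrightarrow> reduced g \<and> set g \<subseteq> letters"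
  by (auto simp: free_group_def letters_def)

lemma carrierD:
  assumes "g \<in> carrier F"
  shows "reduced g" "a \<in> set g \<Longrightarrow> a \<in> letters" "g \<noteq> [] \<Longrightarrow> hd g \<in> letters" "g \<noteq> [] \<Longrightarrow> last g \<in> letters"
  using assms hd_in_set last_in_set unfolding carrier_iff by blast+

lemma one_eq [simp]: "\<one>\<^bsub>F\<^esub> = []"
  by (simp add: free_group_def)

lemma mult_Nil [simp]:
  "h \<in> carrier F \<Longrightarrow> [] \<otimes>\<^bsub>F\<^esub> h = h" "h \<in> carrier F \<Longrightarrow> h \<otimes>\<^bsub>F\<^esub> [] = h"
  using F.l_one F.r_one by simp_all

lemma mult_eq: "g \<otimes>\<^bsub>F\<^esub> h = reduce (g @ h)"
  by (simp add: free_group_def)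

lemma mult_append: "reduced (g @ h) \<Longrightarrow> g \<otimes>\<^bsub>F\<^esub> h = g @ h"
  by (simp add: mult_eq reduce_reduced)

lemma inv_eq: "g \<in> carrier F \<Longrightarrow> inv\<^bsub>F\<^esub> g = rev (map inv_letter g)"
proof (rule F.inv_equality)
  assume g: "g \<in> carrier F"
  show "rev (map inv_letter g) \<in> carrier F"
    using g by (force simp: free_group_def reduced_inverse)
qed (simp_all add: mult_eq reduce_inverse)

lemma conj_append:
  assumes "g \<in> carrier F" "reduced (g @ w @ rev (map inv_letter g))"
  shows "g \<otimes>\<^bsub>F\<^esub> w \<otimes>\<^bsub>F\<^esub> inv\<^bsub>F\<^esub> g = g @ w @ rev (map inv_letter g)"
  using assms by (simp add: inv_eq mult_append reduced_append_iff mult_eq reduce_reduce_left reduce_reduced)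

text \<open>Turns normality inside the restricted structure into conjugation in \<open>F\<close>, so
  that all products and inverses are those of the free group.\<close>

lemma normal_restrict_iff:
  assumes M: "subgroup M F"
  shows "N \<lhd> F\<lparr>carrier := M\<rparr> \<longleftrightarrow>
    subgroup N F \<and> N \<subseteq> M \<and> (\<forall>g\<in>M. \<forall>w\<in>N. g \<otimes>\<^bsub>F\<^esub> w \<otimes>\<^bsub>F\<^esub> inv\<^bsub>F\<^esub> g \<in> N)"
proof -
  interpret M: group "F\<lparr>carrier := M\<rparr>"
    using M by (rule F.subgroup_imp_group)
  have "subgroup N (F\<lparr>carrier := M\<rparr>) \<longleftrightarrow> subgroup N F \<and> N \<subseteq> M"
    using F.incl_subgroup[OF M] F.subgroup_incl[OF _ M] subgroup.subset by fastforce
  then show ?thesis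
    using F.m_inv_consistent[OF M] by (auto simp: M.normal_inv_iff)
qed

lemma ball_subset_lists:
  "N \<subseteq> carrier F \<Longrightarrow> {g \<in> N. length g \<le> n} \<subseteq> {xs. set xs \<subseteq> letters \<and> length xs \<le> n}"
  by (auto intro: carrierD)

lemma finite_ball: "N \<subseteq> carrier F \<Longrightarrow> finite {g \<in> N. length g \<le> n}"
  by (rule finite_subset[OF ball_subset_lists finite_lists_length_le[OF finite_letters]])

lemma finite_sphere: "N \<subseteq> carrier F \<Longrightarrow> finite {g \<in> N. length g = n}"
  by (rule finite_subset[OF _ finite_ball[of N n]]) auto

text \<open>A crude count of all words over the alphabet. It serves to bound
  \<open>ln (growth_fun N n) / n\<close>.\<close>

lemma growth_fun_le:
  assumes "N \<subseteq> carrier F" "X \<noteq> {}"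
  shows "growth_fun N n \<le> (4 * card X) ^ n"
proof -
  let ?k = "card letters"
  have k: "?k \<ge> 1" using assms finite_X by (simp add: card_letters Suc_le_eq card_gt_0_iff)
  have "growth_fun N n \<le> card {xs. set xs \<subseteq> letters \<and> length xs \<le> n}"
    unfolding growth_fun_def using assms
    by (intro card_mono finite_lists_length_le finite_letters ball_subset_lists assms)
  also have "\<dots> = (\<Sum>i\<le>n. ?k ^ i)"
    by (rule card_lists_length_le[OF finite_letters])
  also have "\<dots> \<le> (\<Sum>i\<le>n. ?k ^ n)"
    using k by (intro sum_mono power_increasing) auto
  also have "\<dots> = Suc n * ?k ^ n" by simp
  also have "\<dots> \<le> 2 ^ n * ?k ^ n"
    by (intro mult_right_mono) (auto simp: Suc_le_eq)
  also have "\<dots> = (2 * ?k) ^ n" by (simp only: power_mult_distrib)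
  also have "2 * ?k = 4 * card X" by (simp add: card_letters)
  finally show ?thesis .
qed

end

section \<open>Words in subnormal subgroups\<close>

context finite_basis
begin

text \<open>This is the form in which nontriviality is inherited along a subnormal chain.\<close>

definition full :: "'a letter list set \<Rightarrow> bool" where
  "full N \<longleftrightarrow> (\<forall>a\<in>letters. \<forall>b\<in>letters. \<exists>g\<in>N. g \<noteq> [] \<and> hd g = a \<and> last g = b)"

lemma ex_letter:
  assumes "card X \<ge> 2" "finite A" "card A \<le> 3"
  shows "\<exists>c\<in>letters. c \<notin> A"
proof (rule ccontr)
  assume "\<not> ?thesis"
  then have "card letters \<le> card A"
    using assms by (intro card_mono) auto
  then show False using assms by (simp add: card_letters)
qed

lemma ex_letter2:
  assumes "card X \<ge> 2"
  shows "\<exists>c\<in>letters. c \<noteq> p \<and> c \<noteq> q"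
  using ex_letter[OF assms, of "{p, q}"] by (auto simp: card_insert_if)

lemma full_carrier:
  assumes "card X \<ge> 2"
  shows "full (carrier F)"
  unfolding full_def
proof (intro ballI)
  fix a b assume ab: "a \<in> letters" "b \<in> letters"
  obtain c where c: "c \<in> letters" "c \<noteq> inv_letter a" "c \<noteq> a"
    using ex_letter2[OF assms] by metis
  show "\<exists>g\<in>carrier F. g \<noteq> [] \<and> hd g = a \<and> last g = b"
  proof (cases "b = inv_letter a")
    case True
    then show ?thesis using ab c
      by (intro bexI[of _ "[a, c, b]"]) (auto simp: carrier_iff inv_letter_eq_iff)
  next
    case False
    then show ?thesis using ab
      by (intro bexI[of _ "[a, b]"]) (auto simp: carrier_iff)
  qed
qed

text \<open>Conjugating a nontrivial word of \<open>N\<close> by some \<open>g\<close> in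
  \<open>M\<close> whose last letter cancels at neither end of that word gives words from
  \<open>a\<close> to its inverse. Products of two of these reach the remaining pairs of end
  letters.\<close>

lemma full_normal:
  assumes card: "card X \<ge> 2" and M: "subgroup M F" "full M"
    and N: "N \<lhd> F\<lparr>carrier := M\<rparr>" "N \<noteq> {\<one>\<^bsub>F\<^esub>}"
  shows "full N"
proof -
  have sN: "subgroup N F" and conj: "\<And>g w. g \<in> M \<Longrightarrow> w \<in> N \<Longrightarrow> g \<otimes>\<^bsub>F\<^esub> w \<otimes>\<^bsub>F\<^esub> inv\<^bsub>F\<^esub> g \<in> N"
    using N(1) unfolding normal_restrict_iff[OF M(1)] by auto
  obtain w where w: "w \<in> N" "w \<noteq> []"
    using N(2) subgroup.one_closed[OF sN] by auto
  then have wc: "w \<in> carrier F" using subgroup.subset[OF sN] by auto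
  have palin: "\<exists>g\<in>N. g \<noteq> [] \<and> hd g = a \<and> last g = inv_letter a" if a: "a \<in> letters" for a
  proof -
    obtain c where c: "c \<in> letters" "c \<noteq> inv_letter (hd w)" "c \<noteq> last w"
      using ex_letter2[OF card] by metis
    obtain g where g: "g \<in> M" "g \<noteq> []" "hd g = a" "last g = c"
      using M(2) a c unfolding full_def by meson
    have gc: "g \<in> carrier F" using g subgroup.subset[OF M(1)] by auto
    have "reduced (g @ w @ rev (map inv_letter g))"
      using gc wc g w c
      by (auto simp: carrier_iff reduced_append_iff reduced_inverse hd_rev last_map inv_letter_eq_iff)
    from conj_append[OF gc this] conj[OF g(1) w(1)]
    have "g @ w @ rev (map inv_letter g) \<in> N" by simp
    then show ?thesis using g
      by (intro bexI[of _ "g @ w @ rev (map inv_letter g)"]) (auto simp: last_rev hd_map)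
  qed
  show ?thesis unfolding full_def
  proof (intro ballI)
    fix a b assume ab: "a \<in> letters" "b \<in> letters"
    obtain g where g: "g \<in> N" "g \<noteq> []" "hd g = a" "last g = inv_letter a"
      using palin ab by metis
    show "\<exists>g\<in>N. g \<noteq> [] \<and> hd g = a \<and> last g = b"
    proof (cases "b = inv_letter a")
      case True
      then show ?thesis using g by auto
    next
      case False
      obtain h where h: "h \<in> N" "h \<noteq> []" "hd h = inv_letter b" "last h = b"
        using palin[of "inv_letter b"] ab by auto
      have "g \<in> carrier F" "h \<in> carrier F" using g h subgroup.subset[OF sN] by auto
      then have "reduced (g @ h)"
        using g h False by (auto simp: carrier_iff reduced_append_iff inv_letter_eq_iff)
      then have "g @ h \<in> N"
        using subgroup.m_closed[OF sN g(1) h(1)] by (simp add: mult_append)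
      then show ?thesis using g h by (intro bexI[of _ "g @ h"]) auto
    qed
  qed
qed

lemma full_connectors:
  assumes "full N"
  obtains w L where "\<And>a b. a \<in> letters \<Longrightarrow> b \<in> letters \<Longrightarrow>
      w a b \<in> N \<and> w a b \<noteq> [] \<and> hd (w a b) = a \<and> last (w a b) = b \<and> length (w a b) \<le> L"
proof -
  obtain w where w: "\<And>a b. a \<in> letters \<Longrightarrow> b \<in> letters \<Longrightarrow>
      w a b \<in> N \<and> w a b \<noteq> [] \<and> hd (w a b) = a \<and> last (w a b) = b"
    using assms unfolding full_def by metis
  let ?L = "\<Sum>(a, b)\<in>letters \<times> letters. length (w a b)"
  have "length (w a b) \<le> ?L" if "a \<in> letters" "b \<in> letters" for a b
    using member_le_sum[of "(a, b)" "letters \<times> letters" "\<lambda>(a, b). length (w a b)"] that finite_letters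
    by auto
  with w show ?thesis by (intro that[of w ?L]) auto
qed

text \<open>Join \<open>g\<close> and \<open>h\<close> by a connecting word that starts with the
  last letter of \<open>g\<close> and ends with the first letter of \<open>h\<close>, so that
  nothing cancels. As the length of \<open>g\<close> is fixed and the two end letters are recorded,
  \<open>g\<close> and \<open>h\<close> can be recovered. The factor
  \<open>(2 * card X)\<^sup>2\<close> counts the recorded pairs.\<close>

lemma sphere_ball_le:
  assumes X: "X \<noteq> {}" and N: "subgroup N F" "full N"
  shows "\<exists>L. \<forall>p n. card {g \<in> N. length g = p} * growth_fun N n
           \<le> (2 * card X)\<^sup>2 * growth_fun N (n + p + L)"
proof -
  have NF: "N \<subseteq> carrier F" using N(1) subgroup.subset by auto
  obtain w L where w: "\<And>a b. a \<in> letters \<Longrightarrow> b \<in> letters \<Longrightarrow>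
      w a b \<in> N \<and> w a b \<noteq> [] \<and> hd (w a b) = a \<and> last (w a b) = b \<and> length (w a b) \<le> L"
    using full_connectors[OF N(2)] by metis
  obtain x where x: "x \<in> X" using X by auto
  \<comment> \<open>The empty word has no end letters. An arbitrary letter serves as default, since
    nothing can cancel against it.\<close>
  define e where "e g = (if g = [] then (x, True) else last g)" for g :: "'a letter list"
  define s where "s g = (if g = [] then (x, True) else hd g)" for g :: "'a letter list"
  have es: "e g \<in> letters" "s g \<in> letters" if "g \<in> N" for g
    using that NF x by (auto simp: e_def s_def letters_def intro!: carrierD[unfolded letters_def])
  define f where "f = (\<lambda>(g, h). ((e g, s h), g @ w (e g) (s h) @ h))"
  have fN: "g @ w (e g) (s h) @ h \<in> N" if "g \<in> N" "h \<in> N" for g h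
  proof -
    have ww: "w (e g) (s h) \<in> N" "w (e g) (s h) \<noteq> []" "hd (w (e g) (s h)) = e g" "last (w (e g) (s h)) = s h"
      using w es that by auto
    have "g \<in> carrier F" "h \<in> carrier F" "w (e g) (s h) \<in> carrier F" using that ww NF by auto
    then have "reduced (g @ w (e g) (s h) @ h)"
      using ww by (auto simp: carrier_iff reduced_append_iff e_def s_def)
    moreover have "g \<otimes>\<^bsub>F\<^esub> (w (e g) (s h) \<otimes>\<^bsub>F\<^esub> h) \<in> N"
      using that ww N(1) by (intro subgroup.m_closed) auto
    ultimately show ?thesis
      by (simp add: mult_append reduced_append_iff)
  qed
  show ?thesis
  proof (intro exI allI)
    fix p n
    let ?A = "{g \<in> N. length g = p} \<times> {g \<in> N. length g \<le> n}"
    let ?B = "(letters \<times> letters) \<times> {g \<in> N. length g \<le> n + p + L}"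
    have "inj_on f ?A" by (auto simp: inj_on_def f_def)
    moreover have "f ` ?A \<subseteq> ?B"
    proof (rule image_subsetI)
      fix gh assume "gh \<in> ?A"
      then obtain g h where gh: "gh = (g, h)" "g \<in> N" "length g = p" "h \<in> N" "length h \<le> n" by auto
      show "f gh \<in> ?B"
        using fN[OF gh(2,4)] es[OF gh(2)] es[OF gh(4)] w[of "e g" "s h"] gh
        by (simp add: f_def)
    qed
    moreover have "finite ?B" using finite_letters finite_ball[OF NF] by simp
    ultimately have "card ?A \<le> card ?B" by (rule card_inj_on_le)
    then show "card {g \<in> N. length g = p} * growth_fun N n
           \<le> (2 * card X)\<^sup>2 * growth_fun N (n + p + L)"
      by (simp add: growth_fun_def card_cartesian_product card_letters power2_eq_square mult_ac)
  qed
qed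

lemma growth_fun_eq_sum:
  assumes "N \<subseteq> carrier F"
  shows "growth_fun N n = (\<Sum>p\<le>n. card {g \<in> N. length g = p})"
proof -
  have "{g \<in> N. length g \<le> n} = (\<Union>p\<le>n. {g \<in> N. length g = p})" by auto
  then show ?thesis unfolding growth_fun_def
    by (simp add: card_UN_disjoint finite_sphere[OF assms] disjoint_iff)
qed

lemma growth_fun_mono:
  assumes "N \<subseteq> carrier F" "n \<le> k"
  shows "growth_fun N n \<le> growth_fun N k"
  unfolding growth_fun_def using assms by (intro card_mono finite_ball) auto

lemma growth_fun_mult_le:
  assumes X: "X \<noteq> {}" and N: "subgroup N F" "full N"
  shows "\<exists>L. \<forall>n k. growth_fun N k * growth_fun N n
           \<le> (2 * card X)\<^sup>2 * (k + 1) * growth_fun N (n + k + L)"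
proof -
  have NF: "N \<subseteq> carrier F" using N(1) subgroup.subset by auto
  obtain L where L: "\<And>p n. card {g \<in> N. length g = p} * growth_fun N n
           \<le> (2 * card X)\<^sup>2 * growth_fun N (n + p + L)"
    using sphere_ball_le[OF assms] by auto
  have "growth_fun N k * growth_fun N n \<le> (2 * card X)\<^sup>2 * (k + 1) * growth_fun N (n + k + L)" for n k
  proof -
    have "growth_fun N k * growth_fun N n = (\<Sum>p\<le>k. card {g \<in> N. length g = p} * growth_fun N n)"
      by (simp add: growth_fun_eq_sum[OF NF, of k] sum_distrib_right)
    also have "\<dots> \<le> (\<Sum>p\<le>k. (2 * card X)\<^sup>2 * growth_fun N (n + k + L))"
      by (intro sum_mono order.trans[OF L] mult_left_mono growth_fun_mono[OF NF]) auto
    finally show ?thesis by (simp add: algebra_simps)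
  qed
  then show ?thesis by blast
qed

text \<open>Conjugate by \<open>g\<close> a connecting word from the last letter of \<open>g\<close>
  to its inverse. The result is reduced, lies in \<open>N\<close>, and has \<open>g\<close> as a
  prefix, so \<open>g\<close> is determined by it.\<close>

lemma sphere_conj_le:
  assumes X: "X \<noteq> {}" and M: "subgroup M F" and N: "N \<lhd> F\<lparr>carrier := M\<rparr>" "full N"
  shows "\<exists>L. \<forall>n. card {g \<in> M. length g = n} \<le> growth_fun N (2 * n + L)"
proof -
  have sN: "subgroup N F" and conj: "\<And>g w. g \<in> M \<Longrightarrow> w \<in> N \<Longrightarrow> g \<otimes>\<^bsub>F\<^esub> w \<otimes>\<^bsub>F\<^esub> inv\<^bsub>F\<^esub> g \<in> N"
    using N(1) unfolding normal_restrict_iff[OF M] by auto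
  have NF: "N \<subseteq> carrier F" and MF: "M \<subseteq> carrier F" using sN M subgroup.subset by auto
  obtain w L where w: "\<And>a b. a \<in> letters \<Longrightarrow> b \<in> letters \<Longrightarrow>
      w a b \<in> N \<and> w a b \<noteq> [] \<and> hd (w a b) = a \<and> last (w a b) = b \<and> length (w a b) \<le> L"
    using full_connectors[OF N(2)] by metis
  obtain x where x: "x \<in> X" using X by auto
  define e where "e g = (if g = [] then (x, True) else last g)" for g :: "'a letter list"
  have e: "e g \<in> letters" if "g \<in> M" for g
    using that MF x by (auto simp: e_def letters_def intro!: carrierD[unfolded letters_def])
  define f where "f g = g @ w (e g) (inv_letter (e g)) @ rev (map inv_letter g)" for g
  have fN: "f g \<in> N" if "g \<in> M" for g
  proof -
    let ?w = "w (e g) (inv_letter (e g))"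
    have ww: "?w \<in> N" "?w \<noteq> []" "hd ?w = e g" "last ?w = inv_letter (e g)"
      using w e[OF that] by auto
    have gc: "g \<in> carrier F" "?w \<in> carrier F" using that ww NF MF by auto
    then have "reduced (g @ ?w @ rev (map inv_letter g))"
      using ww by (auto simp: carrier_iff reduced_append_iff reduced_inverse e_def hd_rev last_map)
    from conj_append[OF gc(1) this] conj[OF that ww(1)] show ?thesis
      by (simp add: f_def)
  qed
  have "card {g \<in> M. length g = n} \<le> growth_fun N (2 * n + L)" for n
    unfolding growth_fun_def
  proof (rule card_inj_on_le[of f])
    show "inj_on f {g \<in> M. length g = n}" by (auto simp: inj_on_def f_def)
    show "f ` {g \<in> M. length g = n} \<subseteq> {g \<in> N. length g \<le> 2 * n + L}"
      using fN w[OF e, of _ "inv_letter (e _)"] e by (force simp: f_def)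
  qed (rule finite_ball[OF NF])
  then show ?thesis by blast
qed

text \<open>Words whose first and last letters are mutually inverse admit the maximal number
  \<open>2 * card X - 1\<close> of reduced conjugates by a letter.\<close>

definition palin_count :: "'a letter list set \<Rightarrow> nat \<Rightarrow> nat" where
  "palin_count N n = card {g \<in> N. length g = n \<and> g \<noteq> [] \<and> last g = inv_letter (hd g)}"

text \<open>Conjugation by a letter is injective on the admissible pairs of \<open>P n\<close> and
  yields words with mutually inverse ends. A word that already has such ends forbids one letter
  only. The extra summand in the last estimate comes from words \<open>v g\<close> in
  \<open>N\<close> without such ends, each of which admits at least one conjugating letter.\<close>

lemma palin_count_rec:
  assumes X: "card X \<ge> 2" and N: "N \<lhd> F" "full N"
  obtains r where "palin_count N (2 * r) \<ge> 1"
    "\<And>n. palin_count N (n + 2) \<ge> (2 * card X - 1) * palin_count N n"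
    "\<And>n. palin_count N (n + 2 * r + 2) \<ge> (2 * card X - 1) * palin_count N (n + 2 * r) + palin_count N n"
proof -
  have N': "N \<lhd> F\<lparr>carrier := carrier F\<rparr>" using N(1) by simp
  have sN: "subgroup N F" and conj: "\<And>g w. g \<in> carrier F \<Longrightarrow> w \<in> N \<Longrightarrow> g \<otimes>\<^bsub>F\<^esub> w \<otimes>\<^bsub>F\<^esub> inv\<^bsub>F\<^esub> g \<in> N"
    using N' unfolding normal_restrict_iff[OF F.subgroup_self] by auto
  have NF: "N \<subseteq> carrier F" using sN subgroup.subset by auto
  define D where "D n = {g \<in> N. length g = n \<and> g \<noteq> [] \<and> last g = inv_letter (hd g)}" for n
  have D: "palin_count N n = card (D n)" for n by (simp add: D_def palin_count_def)
  have fin: "finite (D n)" for n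
    by (rule finite_subset[OF _ finite_sphere[OF NF, of n]]) (auto simp: D_def)
  define P where "P n = {(c, g). c \<in> letters \<and> g \<in> N \<and> length g = n \<and> g \<noteq> [] \<and> c \<noteq> inv_letter (hd g) \<and> c \<noteq> last g}" for n
  have finP: "finite (P n)" for n
    by (rule finite_subset[OF _ finite_cartesian_product[OF finite_letters finite_sphere[OF NF, of n]]])
       (auto simp: P_def)
  have conjN: "c # g @ [inv_letter c] \<in> D (n + 2)" if "(c, g) \<in> P n" for c g n
  proof -
    have c: "[c] \<in> carrier F" "g \<in> carrier F" using that NF by (auto simp: P_def) (auto simp: carrier_iff)
    then have "reduced ([c] @ g @ rev (map inv_letter [c]))"
      using that by (auto simp: P_def carrier_iff reduced_append_iff reduced_Cons_iff inv_letter_eq_iff hd_append)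
    from conj_append[OF c(1) this] conj[OF c(1), of g] that
    show ?thesis by (simp add: P_def D_def)
  qed
  have PD: "card (P n) \<le> card (D (n + 2))" for n
  proof (rule card_inj_on_le)
    show "inj_on (\<lambda>(c, g). c # g @ [inv_letter c]) (P n)" by (auto simp: inj_on_def)
    show "(\<lambda>(c, g). c # g @ [inv_letter c]) ` P n \<subseteq> D (n + 2)" using conjN by auto
  qed (rule fin)
  define Q where "Q n = (SIGMA g:D n. letters - {inv_letter (hd g)})" for n
  have cardQ: "card (Q n) = (2 * card X - 1) * card (D n)" for n
  proof -
    have "card (letters - {inv_letter (hd g)}) = 2 * card X - 1" if "g \<in> D n" for g
    proof -
      have "g \<in> carrier F" "g \<noteq> []" using that NF by (auto simp: D_def)
      then have "hd g \<in> letters" using hd_in_set[of g] unfolding carrier_iff by blast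
      then show ?thesis
        using finite_letters by (simp add: card_letters[symmetric] card_Diff_singleton)
    qed
    then show ?thesis unfolding Q_def using fin finite_letters
      by (subst card_SigmaI) auto
  qed
  \<comment> \<open>For \<open>g\<close> in \<open>D n\<close> the two conditions on
    \<open>c\<close> in \<open>P n\<close> coincide.\<close>
  have QP: "prod.swap ` Q n \<subseteq> P n" for n
    by (auto simp: Q_def P_def D_def)
  have step1: "(2 * card X - 1) * card (D n) \<le> card (D (n + 2))" for n
  proof -
    have "card (Q n) = card (prod.swap ` Q n)" by (simp add: card_image)
    also have "\<dots> \<le> card (P n)" by (rule card_mono[OF finP QP])
    also note PD
    finally show ?thesis by (simp add: cardQ)
  qed
  obtain x y where xy: "x \<in> X" "y \<in> X" "x \<noteq> y"
    using X by (metis card_le_Suc0_iff_eq finite_X not_less_eq_eq numeral_2_eq_2)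
  define a where "a = (x, True)"
  have a: "a \<in> letters" using xy by (simp add: a_def letters_def)
  obtain w where w: "w \<in> N" "w \<noteq> []" "hd w = a" "last w = a"
    using N(2) a unfolding full_def by metis
  have "w \<in> carrier F" using w NF by auto
  then have ww: "reduced (w @ w)" using w by (auto simp: carrier_iff reduced_append_iff)
  have wwN: "w @ w \<in> N" using subgroup.m_closed[OF sN w(1) w(1)] ww by (simp add: mult_append)
  \<comment> \<open>The square of \<open>w\<close> has even length, hence \<open>u b\<close> has
    length exactly \<open>2 * r\<close>.\<close>
  define r where "r = length w + 1"
  define u where "u b = (y, b) # (w @ w) @ [inv_letter (y, b)]" for b
  have uP: "((y, b), w @ w) \<in> P (2 * length w)" for b
    using xy w wwN by (auto simp: P_def a_def letters_def)
  have uD: "u b \<in> D (2 * r)" for b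
    using conjN[OF uP[of b]] by (simp add: u_def r_def)
  \<comment> \<open>The sign of \<open>y\<close> is chosen such that \<open>u\<close> and
    \<open>g\<close> start with different letters. Then \<open>u @ g\<close> is reduced, and its
    last letter is not inverse to its first.\<close>
  define v where "v g = u (\<not> snd (hd g)) @ g" for g
  have hv: "hd (u (\<not> snd (hd g))) \<noteq> hd g" for g
    by (cases "hd g") (auto simp: u_def)
  have "\<forall>g. \<exists>c. c \<in> letters \<and> c \<noteq> inv_letter (hd (v g)) \<and> c \<noteq> last (v g)"
    using ex_letter2[OF X] by blast
  from choice[OF this] obtain c
    where c: "\<And>g. c g \<in> letters \<and> c g \<noteq> inv_letter (hd (v g)) \<and> c g \<noteq> last (v g)"
    by blast
  have vN: "v g \<in> N \<and> length (v g) = n + 2 * r \<and> v g \<noteq> [] \<and> last (v g) \<noteq> inv_letter (hd (v g))"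
    if g: "g \<in> D n" for g n
  proof -
    let ?u = "u (\<not> snd (hd g))"
    have uN: "?u \<in> N" "?u \<noteq> []" "last ?u = inv_letter (hd ?u)" "length ?u = 2 * r"
      and gN: "g \<in> N" "g \<noteq> []" "last g = inv_letter (hd g)" "length g = n"
      using uD g by (auto simp: D_def)
    have "?u \<in> carrier F" "g \<in> carrier F" using uN gN NF by auto
    then have "reduced (?u @ g)"
      using hv[of g] uN gN by (auto simp: carrier_iff reduced_append_iff)
    then have "v g \<in> N" using subgroup.m_closed[OF sN uN(1) gN(1)] by (simp add: mult_append v_def)
    moreover have "last (v g) \<noteq> inv_letter (hd (v g))"
      using hv[of g] uN gN by (auto simp: v_def inv_letter_eq_iff)
    ultimately show ?thesis using uN gN by (simp add: v_def)
  qed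
  have step2: "(2 * card X - 1) * card (D (n + 2 * r)) + card (D n) \<le> card (D (n + 2 * r + 2))" for n
  proof -
    let ?V = "(\<lambda>g. (c g, v g)) ` D n"
    have "inj_on (\<lambda>g. (c g, v g)) (D n)"
    proof (rule inj_onI)
      fix g h assume gh: "g \<in> D n" "h \<in> D n" "(c g, v g) = (c h, v h)"
      then have "drop (2 * r) (v g) = drop (2 * r) (v h)" by simp
      moreover have "drop (2 * r) (v k) = k" for k
        using uD[of "\<not> snd (hd k)"] by (simp add: v_def D_def)
      ultimately show "g = h" by simp
    qed
    then have "(2 * card X - 1) * card (D (n + 2 * r)) + card (D n)
        = card (prod.swap ` Q (n + 2 * r)) + card ?V"
      by (simp add: card_image cardQ)
    also have "\<dots> = card (prod.swap ` Q (n + 2 * r) \<union> ?V)"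
    proof (rule card_Un_disjoint[symmetric])
      show "finite (prod.swap ` Q (n + 2 * r))" using finite_subset[OF QP finP] .
      show "prod.swap ` Q (n + 2 * r) \<inter> ?V = {}"
      proof (rule equals0I)
        fix y assume y: "y \<in> prod.swap ` Q (n + 2 * r) \<inter> ?V"
        then have "snd y \<in> D (n + 2 * r)" by (auto simp: Q_def)
        moreover obtain g where "g \<in> D n" "snd y = v g" using y by auto
        ultimately show False using vN[of g n] by (simp add: D_def)
      qed
    qed (use fin in auto)
    also have "\<dots> \<le> card (P (n + 2 * r))"
    proof (rule card_mono[OF finP])
      show "prod.swap ` Q (n + 2 * r) \<union> ?V \<subseteq> P (n + 2 * r)"
      proof (rule Un_least[OF QP image_subsetI])
        fix g assume "g \<in> D n"
        then show "(c g, v g) \<in> P (n + 2 * r)" using vN[of g n] c[of g] by (simp add: P_def)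
      qed
    qed
    also note PD
    finally show ?thesis .
  qed
  have "card (D (2 * r)) \<ge> 1"
    using uD[of True] fin[of "2 * r"] by (auto simp: Suc_le_eq card_gt_0_iff)
  with step1 step2 show ?thesis by (intro that[of r]) (auto simp: D)
qed

end

section \<open>The growth rate\<close>

text \<open>A version of Fekete's lemma with a shift \<open>L\<close> and a logarithmic error.
  Iterating the hypothesis bounds \<open>g\<close> from below along multiples of \<open>d k\<close>,
  and the limit is the supremum of the ratios \<open>t k\<close>.\<close>

lemma superadditive_log_error_convergent:
  fixes g :: "nat \<Rightarrow> real" and B c :: real
  assumes "mono g" and nonneg: "\<And>n. g n \<ge> 0" and bound: "\<And>n. g n \<le> B * n"
    and super: "\<And>n k. g k + g n \<le> c + ln (real k + 1) + g (n + k + L)"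
  shows "\<exists>A. (\<lambda>n. g n / n) \<longlonglongrightarrow> A"
proof -
  \<comment> \<open>The additional 1 keeps \<open>d k\<close> positive for k = L = 0; monotonicity
    of \<open>g\<close> absorbs it.\<close>
  define d where "d k = k + L + 1" for k
  define \<tau> where "\<tau> k = g k - c - ln (real k + 1)" for k
  have iter: "j * \<tau> k \<le> g (j * d k)" for j k
  proof (induction j)
    case 0
    then show ?case using nonneg[of 0] by simp
  next
    case (Suc j)
    have "\<tau> k + g (j * d k) \<le> g (j * d k + k + L)"
      using super[of k "j * d k"] by (simp add: \<tau>_def)
    also have "\<dots> \<le> g (Suc j * d k)"
      by (rule monoD[OF \<open>mono g\<close>]) (auto simp: d_def)
    finally show ?case using Suc by (simp add: algebra_simps)
  qed
  have dpos: "d k > 0" for k by (simp add: d_def)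
  define t where "t k = \<tau> k / d k" for k
  have "t k \<le> B" for k
    using iter[of 1 k] bound[of "d k"] dpos[of k] by (simp add: t_def divide_simps)
  then have bdd: "bdd_above (range t)" by (auto simp: bdd_above_def)
  define A where "A = (SUP k. t k)"
  have lower: "g n / n \<ge> t k - \<bar>\<tau> k\<bar> / n" if "n > 0" for n k
  proof (cases "\<tau> k \<ge> 0")
    case True
    define j where "j = n div d k"
    have "n < (j + 1) * d k"
      using dividend_less_div_times[OF dpos, of n k] by (simp add: j_def)
    then have "real n < real ((j + 1) * d k)" by (simp only: of_nat_less_iff)
    then have "real n < (real j + 1) * d k" by (simp add: algebra_simps)
    then have "n / d k - 1 \<le> j" using dpos[of k] by (simp add: field_simps)
    then have "(n / d k - 1) * \<tau> k \<le> j * \<tau> k" using True by (intro mult_right_mono)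
    also have "\<dots> \<le> g (j * d k)" by (rule iter)
    also have "\<dots> \<le> g n" by (rule monoD[OF \<open>mono g\<close>]) (auto simp: j_def)
    finally have "(n / d k - 1) * \<tau> k / n \<le> g n / n" by (intro divide_right_mono) auto
    moreover have "(n / d k - 1) * \<tau> k / n = t k - \<bar>\<tau> k\<bar> / n"
      using True that dpos[of k] by (simp add: t_def field_simps)
    ultimately show ?thesis by simp
  next
    case False
    then have "t k \<le> 0" using dpos[of k] by (simp add: t_def divide_simps)
    moreover have "0 \<le> g n / n" "0 \<le> \<bar>\<tau> k\<bar> / n" using nonneg by auto
    ultimately show ?thesis by linarith
  qed
  have upper: "g n / n \<le> (A * (real n + real L + 1) + c + ln (real n + 1)) / real n" for n
  proof -
    have "t n \<le> A" unfolding A_def using bdd by (intro cSUP_upper) auto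
    then have "\<tau> n \<le> A * (real n + real L + 1)" using dpos[of n] by (simp add: t_def d_def divide_simps add_ac)
    then show ?thesis by (intro divide_right_mono) (auto simp: \<tau>_def)
  qed
  have "(\<lambda>n. g n / n) \<longlonglongrightarrow> A"
  proof (rule order_tendstoI)
    fix y assume "y < A"
    then obtain k where k: "y < t k" unfolding A_def using less_cSUP_iff[OF _ bdd] by auto
    have "(\<lambda>n. t k - \<bar>\<tau> k\<bar> / real n) \<longlonglongrightarrow> t k" by real_asymp
    from order_tendstoD(1)[OF this k] eventually_gt_at_top[of 0]
    show "\<forall>\<^sub>F n in sequentially. y < g n / n"
      proof eventually_elim
      case (elim n)
      with lower[of n k] show ?case by linarith
    qed
  next
    fix y assume y: "A < y"
    have "(\<lambda>n. (A * (real n + real L + 1) + c + ln (real n + 1)) / real n) \<longlonglongrightarrow> A" by real_asymp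
    from order_tendstoD(2)[OF this y]
    show "\<forall>\<^sub>F n in sequentially. g n / n < y"
      proof eventually_elim
      case (elim n)
      with upper[of n] show ?case by linarith
    qed
  qed
  then show ?thesis by blast
qed

section \<open>Existence of the growth rate and the lower bound\<close>

context finite_basis
begin

lemma growth_fun_ge_1:
  assumes "subgroup N F"
  shows "growth_fun N n \<ge> 1"
proof -
  have "[] \<in> {g \<in> N. length g \<le> n}" using subgroup.one_closed[OF assms] by simp
  then have "card {g \<in> N. length g \<le> n} > 0"
    using finite_ball[OF subgroup.subset[OF assms]] card_gt_0_iff by blast
  then show ?thesis by (simp add: growth_fun_def)
qed

text \<open>Logarithms turn \<open>growth_fun_mult_le\<close> into approximate superadditivity.
  Since the full limit exists, later estimates may be evaluated along subsequences, and the rate is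
  positive.\<close>

lemma growth_rate_exp:
  assumes X: "X \<noteq> {}" and N: "subgroup N F" "full N"
  obtains A where "(\<lambda>n. ln (growth_fun N n) / n) \<longlonglongrightarrow> A" "growth_rate N = exp A"
proof -
  have NF: "N \<subseteq> carrier F" using N(1) subgroup.subset by auto
  let ?G = "\<lambda>n. real (growth_fun N n)"
  have G: "?G n \<ge> 1" for n using growth_fun_ge_1[OF N(1), of n] by simp
  have G0: "?G n > 0" for n using G[of n] by linarith
  have cX: "card X > 0" using X finite_X by (simp add: card_gt_0_iff)
  obtain L where L: "\<And>n k. growth_fun N k * growth_fun N n
           \<le> (2 * card X)\<^sup>2 * (k + 1) * growth_fun N (n + k + L)"
    using growth_fun_mult_le[OF assms] by blast
  have "\<exists>A. (\<lambda>n. ln (?G n) / n) \<longlonglongrightarrow> A"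
  proof (rule superadditive_log_error_convergent[of _ "ln (4 * real (card X))" "ln ((2 * real (card X))\<^sup>2)" L])
    show "mono (\<lambda>n. ln (?G n))"
      using growth_fun_mono[OF NF] G0 by (intro monoI) simp
    show "ln (?G n) \<ge> 0" for n using G by simp
    show "ln (?G n) \<le> ln (4 * real (card X)) * n" for n
    proof -
      have "?G n \<le> (4 * real (card X)) ^ n"
        using growth_fun_le[OF NF X, of n]
        by (metis of_nat_le_iff of_nat_mult of_nat_numeral of_nat_power)
      then have "ln (?G n) \<le> ln ((4 * real (card X)) ^ n)" using G0 cX by (subst ln_le_cancel_iff) auto
      also have "\<dots> = n * ln (4 * real (card X))" by (rule ln_realpow)
      finally show ?thesis by (simp add: mult.commute)
    qed
    show "ln (?G k) + ln (?G n) \<le> ln ((2 * real (card X))\<^sup>2) + ln (real k + 1) + ln (?G (n + k + L))" for n k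
    proof -
      have "?G k * ?G n \<le> (2 * real (card X))\<^sup>2 * (real k + 1) * ?G (n + k + L)"
        using of_nat_mono[OF L[of k n], where 'a = real] by (simp add: algebra_simps)
      then have "ln (?G k * ?G n) \<le> ln ((2 * real (card X))\<^sup>2 * (real k + 1) * ?G (n + k + L))"
        using G0 cX by (subst ln_le_cancel_iff) (auto intro!: mult_pos_pos)
      then show ?thesis
        using G0[of k] G0[of n] G0[of "n + k + L"] cX by (simp add: ln_mult)
    qed
  qed
  then obtain A where A: "(\<lambda>n. ln (?G n) / n) \<longlonglongrightarrow> A" by blast
  have "(\<lambda>n. exp (ln (?G n) / n)) \<longlonglongrightarrow> exp A" by (intro tendsto_exp A)
  moreover have "\<forall>\<^sub>F n in sequentially. exp (ln (?G n) / n) = root n (?G n)"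
    using eventually_gt_at_top[of 0]
    by eventually_elim (use G0 in \<open>simp add: root_powr_inverse powr_def\<close>)
  ultimately have "(\<lambda>n. root n (?G n)) \<longlonglongrightarrow> exp A" by (rule Lim_transform_eventually)
  then have "growth_rate N = exp A" unfolding growth_rate_def by (rule limI)
  with A that show ?thesis by blast
qed

text \<open>Along the lengths \<open>p + 2 * j\<close> each factor \<sigma> costs two letters, hence
  the square root.\<close>

lemma growth_rate_ge_sqrt:
  fixes C \<sigma> :: real
  assumes X: "X \<noteq> {}" and N: "subgroup N F" "full N"
    and C: "C > 0" "\<sigma> > 0" and ge: "\<And>j. growth_fun N (p + 2 * j) \<ge> C * \<sigma> ^ j"
  shows "growth_rate N \<ge> sqrt \<sigma>"
proof -
  obtain A where A: "(\<lambda>n. ln (growth_fun N n) / n) \<longlonglongrightarrow> A" "growth_rate N = exp A"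
    using growth_rate_exp[OF assms(1-3)] by blast
  have "strict_mono (\<lambda>j. p + 2 * j)" by (auto simp: strict_mono_def)
  from LIMSEQ_subseq_LIMSEQ[OF A(1) this]
  have "(\<lambda>j. ln (growth_fun N (p + 2 * j)) / real (p + 2 * j)) \<longlonglongrightarrow> A" by (simp add: o_def)
  moreover have "(\<lambda>j. (ln C + real j * ln \<sigma>) / real (p + 2 * j)) \<longlonglongrightarrow> ln \<sigma> / 2"
    by real_asymp
  moreover have "(ln C + real j * ln \<sigma>) / real (p + 2 * j) \<le> ln (growth_fun N (p + 2 * j)) / real (p + 2 * j)" for j
  proof (rule divide_right_mono)
    have "ln C + real j * ln \<sigma> = ln (C * \<sigma> ^ j)" using C by (simp add: ln_mult ln_realpow)
    also have "\<dots> \<le> ln (growth_fun N (p + 2 * j))"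
      using C ge[of j] by (intro ln_mono) auto
    finally show "ln C + real j * ln \<sigma> \<le> ln (growth_fun N (p + 2 * j))" .
  qed simp
  ultimately have "ln \<sigma> / 2 \<le> A" by (intro LIMSEQ_le) auto
  moreover have "sqrt \<sigma> = exp (ln \<sigma> / 2)" using C by (simp add: powr_half_sqrt[symmetric] powr_def)
  ultimately show ?thesis using A(2) by simp
qed

lemma growth_rate_le:
  fixes C \<mu> :: real
  assumes X: "X \<noteq> {}" and N: "subgroup N F" "full N"
    and C: "C > 0" "\<mu> \<ge> 1" and le: "\<And>n. card {g \<in> N. length g = n} \<le> C * \<mu> ^ n"
  shows "growth_rate N \<le> \<mu>"
proof -
  have NF: "N \<subseteq> carrier F" using N(1) subgroup.subset by auto
  obtain A where A: "(\<lambda>n. ln (growth_fun N n) / n) \<longlonglongrightarrow> A" "growth_rate N = exp A"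
    using growth_rate_exp[OF assms(1-3)] by blast
  have "(\<lambda>n. (ln (real n + 1) + ln C + real n * ln \<mu>) / real n) \<longlonglongrightarrow> ln \<mu>"
    by real_asymp
  moreover have "ln (growth_fun N n) / n \<le> (ln (real n + 1) + ln C + real n * ln \<mu>) / real n" for n
  proof (rule divide_right_mono)
    have "real (growth_fun N n) = (\<Sum>p\<le>n. real (card {g \<in> N. length g = p}))"
      by (simp add: growth_fun_eq_sum[OF NF])
    also have "\<dots> \<le> (\<Sum>p\<le>n. C * \<mu> ^ n)"
      using C by (intro sum_mono order.trans[OF le] mult_left_mono power_increasing) auto
    also have "\<dots> = (real n + 1) * (C * \<mu> ^ n)" by (simp add: algebra_simps)
    finally have "ln (growth_fun N n) \<le> ln ((real n + 1) * (C * \<mu> ^ n))"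
      using growth_fun_ge_1[OF N(1), of n] by (intro ln_mono) auto
    also have "\<dots> = ln (real n + 1) + ln C + real n * ln \<mu>"
      using C by (simp add: ln_mult ln_realpow)
    finally show "ln (growth_fun N n) \<le> ln (real n + 1) + ln C + real n * ln \<mu>" .
  qed simp
  ultimately have "A \<le> ln \<mu>" using A(1) by (intro LIMSEQ_le[OF A(1)]) auto
  then have "exp A \<le> exp (ln \<mu>)" by simp
  then show ?thesis using A(2) C by simp
qed

text \<open>By \<open>sphere_conj_le\<close>, elements of \<open>M\<close> of length up to n inject,
  up to a factor n + 1, into elements of \<open>N\<close> of length about 2 n. Doubling the length
  squares the rate.\<close>

lemma growth_rate_normal_le:
  assumes X: "X \<noteq> {}" and M: "subgroup M F" "full M" and N: "N \<lhd> F\<lparr>carrier := M\<rparr>" "full N"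
  shows "growth_rate M \<le> (growth_rate N)\<^sup>2"
proof -
  have sN: "subgroup N F" using N(1) unfolding normal_restrict_iff[OF M(1)] by auto
  have NF: "N \<subseteq> carrier F" and MF: "M \<subseteq> carrier F" using sN M subgroup.subset by auto
  obtain A where A: "(\<lambda>n. ln (growth_fun M n) / n) \<longlonglongrightarrow> A" "growth_rate M = exp A"
    using growth_rate_exp[OF X M] by blast
  obtain B where B: "(\<lambda>n. ln (growth_fun N n) / n) \<longlonglongrightarrow> B" "growth_rate N = exp B"
    using growth_rate_exp[OF X sN N(2)] by blast
  obtain L where L: "\<And>n. card {g \<in> M. length g = n} \<le> growth_fun N (2 * n + L)"
    using sphere_conj_le[OF X M(1) N] by blast
  have "strict_mono (\<lambda>n. 2 * n + L)" by (auto simp: strict_mono_def)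
  from LIMSEQ_subseq_LIMSEQ[OF B(1) this]
  have "(\<lambda>n. ln (growth_fun N (2 * n + L)) / real (2 * n + L)) \<longlonglongrightarrow> B" by (simp add: o_def)
  moreover have "(\<lambda>n. ln (real n + 1) / real n) \<longlonglongrightarrow> 0" by real_asymp
  moreover have "(\<lambda>n. real (2 * n + L) / real n) \<longlonglongrightarrow> 2" by real_asymp
  ultimately have "(\<lambda>n. ln (real n + 1) / real n +
      ln (growth_fun N (2 * n + L)) / real (2 * n + L) * (real (2 * n + L) / real n)) \<longlonglongrightarrow> 0 + B * 2"
    by (intro tendsto_add tendsto_mult)
  moreover have "ln (growth_fun M n) / n \<le> ln (real n + 1) / real n +
      ln (growth_fun N (2 * n + L)) / real (2 * n + L) * (real (2 * n + L) / real n)" if n: "n \<ge> 1" for n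
  proof -
    have pos: "real (growth_fun N (2 * n + L)) > 0" "real (growth_fun M n) > 0"
      using growth_fun_ge_1[OF sN, of "2 * n + L"] growth_fun_ge_1[OF M(1), of n] by linarith+
    have "growth_fun M n \<le> (\<Sum>p\<le>n. growth_fun N (2 * n + L))"
      unfolding growth_fun_eq_sum[OF MF]
      by (intro sum_mono order.trans[OF L] growth_fun_mono[OF NF]) auto
    also have "\<dots> = (n + 1) * growth_fun N (2 * n + L)" by simp
    finally have "real (growth_fun M n) \<le> real ((n + 1) * growth_fun N (2 * n + L))" by (rule of_nat_mono)
    also have "\<dots> = (real n + 1) * growth_fun N (2 * n + L)" by (simp add: algebra_simps)
    finally have "ln (growth_fun M n) \<le> ln ((real n + 1) * growth_fun N (2 * n + L))"
      using pos by (intro ln_mono) auto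
    also have "\<dots> = ln (real n + 1) + ln (growth_fun N (2 * n + L))"
      using pos by (simp add: ln_mult)
    finally have "ln (growth_fun M n) / n \<le> (ln (real n + 1) + ln (growth_fun N (2 * n + L))) / n"
      by (intro divide_right_mono) auto
    also have "\<dots> = ln (real n + 1) / real n +
      ln (growth_fun N (2 * n + L)) / real (2 * n + L) * (real (2 * n + L) / real n)"
    proof -
      have "real (2 * n + L) \<noteq> 0" using n by simp
      then show ?thesis by (simp add: add_divide_distrib del: of_nat_add of_nat_mult)
    qed
    finally show ?thesis .
  qed
  ultimately have "A \<le> 0 + B * 2" using A(1) LIMSEQ_le by blast
  then show ?thesis using A(2) B(2) by (simp add: exp_double[symmetric] mult.commute)
qed

text \<open>The delayed term in the recursion of \<open>palin_count_rec\<close> forces growth by a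
  factor strictly above q for every two letters: any \<sigma> with
  \<open>\<sigma> ^ r * (\<sigma> - q) \<le> 1\<close> is a lower rate.\<close>

lemma growth_rate_normal_gt:
  assumes X: "card X \<ge> 2" and N: "N \<lhd> F" "full N"
  shows "growth_rate N > sqrt (2 * real (card X) - 1)"
proof -
  have X0: "X \<noteq> {}" using X by auto
  have sN: "subgroup N F" using N(1) by (rule normal_imp_subgroup)
  have NF: "N \<subseteq> carrier F" using sN subgroup.subset by auto
  define q where "q = 2 * real (card X) - 1"
  have q: "q \<ge> 1" using X by (simp add: q_def)
  let ?D = "\<lambda>n. real (palin_count N n)"
  obtain r where r: "palin_count N (2 * r) \<ge> 1"
    "\<And>n. palin_count N (n + 2) \<ge> (2 * card X - 1) * palin_count N n"
    "\<And>n. palin_count N (n + 2 * r + 2) \<ge> (2 * card X - 1) * palin_count N (n + 2 * r) + palin_count N n"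
    using palin_count_rec[OF assms] by metis
  have D0: "?D (2 * r) \<ge> 1" using r(1) by simp
  have D1: "?D (n + 2) \<ge> q * ?D n" for n
    using of_nat_mono[OF r(2)[of n], where 'a = real] X by (simp add: q_def of_nat_diff)
  have D2: "?D (n + 2 * r + 2) \<ge> q * ?D (n + 2 * r) + ?D n" for n
    using of_nat_mono[OF r(3)[of n], where 'a = real] X by (simp add: q_def of_nat_diff)
  \<comment> \<open>As \<sigma> is at most q + 1, this choice gives
    \<open>\<sigma> ^ r * (\<sigma> - q) \<le> 1\<close>.\<close>
  define \<sigma> where "\<sigma> = q + 1 / (q + 1) ^ r"
  have "1 \<le> (q + 1) ^ r" using q by (intro one_le_power) simp
  then have \<sigma>: "\<sigma> > q" "\<sigma> \<le> q + 1" by (simp_all add: \<sigma>_def)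
  have \<sigma>0: "\<sigma> > 0" "\<sigma> \<ge> 1" using \<sigma> q by auto
  have "\<sigma> ^ r \<le> (q + 1) ^ r" using \<sigma> \<sigma>0 by (intro power_mono) auto
  then have "\<sigma> ^ r * (\<sigma> - q) \<le> (q + 1) ^ r * (\<sigma> - q)" using \<sigma> by (intro mult_right_mono) auto
  also have "\<dots> = 1" using q by (simp add: \<sigma>_def)
  finally have "\<sigma> ^ r * (\<sigma> - q) \<le> 1" .
  then have \<sigma>r: "\<sigma> * \<sigma> ^ r \<le> q * \<sigma> ^ r + 1" by (simp add: algebra_simps)
  \<comment> \<open>The divisor \<open>\<sigma> ^ r\<close> makes the right side at most 1 for
    \<open>j \<le> r\<close>, where only \<open>?D \<ge> 1\<close> is known; from there on the
    recursion applies.\<close>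
  have Dge: "?D (2 * r + 2 * j) \<ge> \<sigma> ^ j / \<sigma> ^ r" for j
  proof (induction j rule: less_induct)
    case (less j)
    have D1': "?D (2 * r + 2 * i) \<ge> 1" for i
    proof (induction i)
      case (Suc i)
      have "1 * 1 \<le> q * ?D (2 * r + 2 * i)" using q Suc by (intro mult_mono) auto
      also note D1[of "2 * r + 2 * i"]
      finally show ?case by (simp add: algebra_simps)
    qed (use D0 in simp)
    show ?case
    proof (cases "j \<le> r")
      case True
      then have "\<sigma> ^ j \<le> \<sigma> ^ r" using \<sigma>0 by (intro power_increasing) auto
      then have "\<sigma> ^ j / \<sigma> ^ r \<le> 1" using \<sigma>0 by simp
      with D1'[of j] show ?thesis by linarith
    next
      case False
      then obtain i where j: "j = i + r + 1" by (metis add.commute add_Suc_right less_natE not_le plus_1_eq_Suc)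
      have "\<sigma> ^ j / \<sigma> ^ r = \<sigma> ^ i / \<sigma> ^ r * (\<sigma> * \<sigma> ^ r)" by (simp add: j power_add)
      also have "\<dots> \<le> \<sigma> ^ i / \<sigma> ^ r * (q * \<sigma> ^ r + 1)"
        using \<sigma>r \<sigma>0 by (intro mult_left_mono) auto
      also have "\<dots> = q * (\<sigma> ^ (i + r) / \<sigma> ^ r) + \<sigma> ^ i / \<sigma> ^ r"
        using \<sigma>0 by (simp add: power_add field_simps)
      also have "\<dots> \<le> q * ?D (2 * r + 2 * (i + r)) + ?D (2 * r + 2 * i)"
        using less.IH[of "i + r"] less.IH[of i] q j by (intro add_mono mult_left_mono) auto
      also have "\<dots> \<le> ?D (2 * r + 2 * j)"
        using D2[of "2 * r + 2 * i"] by (simp add: j algebra_simps)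
      finally show ?thesis .
    qed
  qed
  have "growth_rate N \<ge> sqrt \<sigma>"
  proof (rule growth_rate_ge_sqrt[OF X0 sN N(2), of "1 / \<sigma> ^ r" \<sigma> "2 * r"])
    fix j
    have "palin_count N (2 * r + 2 * j) \<le> growth_fun N (2 * r + 2 * j)"
      unfolding palin_count_def growth_fun_def by (intro card_mono finite_ball NF) auto
    with Dge[of j] show "1 / \<sigma> ^ r * \<sigma> ^ j \<le> real (growth_fun N (2 * r + 2 * j))" by simp
  qed (use \<sigma>0 in auto)
  moreover have "sqrt \<sigma> > sqrt q" using \<sigma> by simp
  ultimately show ?thesis unfolding q_def[symmetric] by linarith
qed

text \<open>Every term of the chain contains \<open>N\<close> and is therefore nontrivial, so
  fullness descends step by step by \<open>full_normal\<close>.\<close>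

lemma subnormal_chain_full:
  assumes X: "card X \<ge> 2" and N: "l_subnormal l N F" "N \<noteq> {\<one>\<^bsub>F\<^esub>}"
  obtains S where "S 0 = carrier F" "S l = N" "\<And>i. i < l \<Longrightarrow> S (Suc i) \<lhd> F\<lparr>carrier := S i\<rparr>"
    "\<And>i. i \<le> l \<Longrightarrow> subgroup (S i) F" "\<And>i. i \<le> l \<Longrightarrow> full (S i)"
proof -
  obtain S where S: "S 0 = carrier F" "S l = N" "\<And>i. i < l \<Longrightarrow> S (Suc i) \<lhd> F\<lparr>carrier := S i\<rparr>"
    using N(1) unfolding l_subnormal_def by blast
  have sub: "subgroup (S i) F" if "i \<le> l" for i
    using that
  proof (induction i)
    case 0
    then show ?case using S(1) F.subgroup_self by simp
  next
    case (Suc i)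
    then show ?case using S(3)[of i] normal_restrict_iff[of "S i"] by auto
  qed
  have "S l \<subseteq> S i" if "i \<le> l" for i
    using that
  proof (induction i rule: inc_induct)
    case (step i)
    then show ?case using S(3)[of i] normal_restrict_iff[OF sub[of i]] by auto
  qed simp
  then have nt: "S i \<noteq> {\<one>\<^bsub>F\<^esub>}" if "i \<le> l" for i
    using that N(2) S(2) subgroup.one_closed[OF sub[of l]] by auto
  have full: "full (S i)" if "i \<le> l" for i
    using that
  proof (induction i)
    case 0
    then show ?case using S(1) full_carrier[OF X] by simp
  next
    case (Suc i)
    then show ?case using full_normal[OF X sub _ S(3)] nt[of "Suc i"] by auto
  qed
  show ?thesis using that[of S] S sub full by blast
qed

lemma subnormal_full:
  assumes "card X \<ge> 2" "l_subnormal l N F" "N \<noteq> {\<one>\<^bsub>F\<^esub>}"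
  shows "full N"
  using subnormal_chain_full[OF assms] by (metis order_refl)

text \<open>Only the top step of the chain needs the strict bound.\<close>

theorem growth_rate_subnormal_gt:
  assumes X: "card X \<ge> 2" and l: "l \<ge> 1" and N: "l_subnormal l N F" "N \<noteq> {\<one>\<^bsub>F\<^esub>}"
  shows "growth_rate N > (2 * real (card X) - 1) powr (2 powr (- real l))"
proof -
  have X0: "X \<noteq> {}" using X by auto
  obtain S where S: "S 0 = carrier F" "S l = N" "\<And>i. i < l \<Longrightarrow> S (Suc i) \<lhd> F\<lparr>carrier := S i\<rparr>"
    and sub: "\<And>i. i \<le> l \<Longrightarrow> subgroup (S i) F" and full: "\<And>i. i \<le> l \<Longrightarrow> full (S i)"
    using subnormal_chain_full[OF X N] by metis
  let ?q = "2 * real (card X) - 1"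
  have q: "?q > 1" using X by simp
  have "growth_rate (S i) > ?q powr (2 powr (- real i))" if "1 \<le> i" "i \<le> l" for i
    using that
  proof (induction i rule: dec_induct)
    case base
    have "S 1 \<lhd> F" using S(1) S(3)[of 0] l by simp
    from growth_rate_normal_gt[OF X this full] l q
    show ?case by (simp add: powr_minus powr_half_sqrt inverse_eq_divide)
  next
    case (step i)
    obtain A where "growth_rate (S (Suc i)) = exp A"
      using growth_rate_exp[OF X0 sub[of "Suc i"] full[of "Suc i"]] step by auto
    then have pos: "growth_rate (S (Suc i)) > 0" by simp
    have "(?q powr (2 powr (- real (Suc i))))\<^sup>2 = ?q powr (2 powr (- real (Suc i)) * 2)"
      using q by (simp add: powr_power mult.commute)
    also have "2 powr (- real (Suc i)) * 2 = 2 powr (- real i)"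
      by (simp add: powr_diff powr_minus field_simps powr_add)
    also have "?q powr (2 powr (- real i)) < growth_rate (S i)" using step by simp
    also have "\<dots> \<le> (growth_rate (S (Suc i)))\<^sup>2"
      using step by (intro growth_rate_normal_le X0 sub full S(3)) auto
    finally show ?case using pos by (intro power2_less_imp_less[of _ "growth_rate (S (Suc i))"]) auto
  qed
  with S(2) l show ?thesis by auto
qed

end

section \<open>Superharmonic functions and growth\<close>

context finite_basis
begin

lemma mult_foldr: "reduced h \<Longrightarrow> g \<otimes>\<^bsub>F\<^esub> h = foldr push_letter g h"
  using reduce_reduced[of h] by (simp add: mult_eq reduce_def)

lemma push_closed: "a \<in> letters \<Longrightarrow> h \<in> carrier F \<Longrightarrow> push_letter a h \<in> carrier F"
  using set_push[of a h] by (auto simp: carrier_iff reduced_push)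

lemma push_eq_mult: "h \<in> carrier F \<Longrightarrow> push_letter a h = [a] \<otimes>\<^bsub>F\<^esub> h"
  by (simp add: mult_foldr carrier_iff)

lemma push_mult:
  "g \<in> carrier F \<Longrightarrow> h \<in> carrier F \<Longrightarrow> push_letter a (g \<otimes>\<^bsub>F\<^esub> h) = push_letter a g \<otimes>\<^bsub>F\<^esub> h"
  by (simp add: mult_foldr carrier_iff foldr_push_push)

lemma push_pow_closed: "a \<in> letters \<Longrightarrow> h \<in> carrier F \<Longrightarrow> (push_letter a ^^ n) h \<in> carrier F"
  by (induction n) (auto intro: push_closed)

lemma letter_closed: "a \<in> letters \<Longrightarrow> [a] \<in> carrier F"
  by (simp add: carrier_iff)

lemma push_pow_eq_mult:
  assumes "a \<in> letters" "h \<in> carrier F"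
  shows "(push_letter a ^^ n) h = [a] [^]\<^bsub>F\<^esub> n \<otimes>\<^bsub>F\<^esub> h"
proof (induction n)
  case (Suc n)
  have "[a] [^]\<^bsub>F\<^esub> Suc n = [a] \<otimes>\<^bsub>F\<^esub> [a] [^]\<^bsub>F\<^esub> n"
    using letter_closed[OF assms(1)] by (rule F.nat_pow_Suc2)
  with Suc assms show ?case
    by (simp add: push_eq_mult F.m_assoc letter_closed del: F.nat_pow_Suc)
qed (use assms in simp)

text \<open>\<open>on_axis x M h\<close> says that \<open>h \<in> \<langle>x\<rangle> M\<close>; natural exponents suffice as soon as \<open>M\<close>
  contains a positive power of \<open>x\<close>.\<close>

definition on_axis :: "'a \<Rightarrow> 'a letter list set \<Rightarrow> 'a letter list \<Rightarrow> bool" where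
  "on_axis x M h \<longleftrightarrow> (\<exists>n. (push_letter (x, True) ^^ n) h \<in> M)"

text \<open>A supersolution bounded on the directed edges of the Schreier graph of \<open>M\<close> bounds the growth
  of \<open>M\<close> by \<open>\<beta>\<close>. The pair \<open>(h, a)\<close> stands for the edge with label \<open>a\<close> that ends in \<open>h\<close>, and a
  word is read from right to left.\<close>

definition controlled :: "'a \<Rightarrow> 'a letter list set \<Rightarrow> real \<Rightarrow> bool" where
  "controlled x M \<beta> \<longleftrightarrow> (\<exists>G C. \<forall>h\<in>carrier F. \<forall>a\<in>letters. 0 \<le> G h a \<and> G h a \<le> C \<and>
     (\<forall>\<nu>\<in>M. G (h \<otimes>\<^bsub>F\<^esub> \<nu>) a = G h a) \<and>
     (\<Sum>b\<in>letters - {inv_letter a}. G (push_letter b h) b) + of_bool (on_axis x M h) \<le> \<beta> * G h a)"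

lemma card_letters_Diff: "a \<in> letters \<Longrightarrow> card (letters - {inv_letter a}) = 2 * card X - 1"
  using finite_letters by (simp add: card_letters card_Diff_singleton)

text \<open>A constant function suffices: with q = 2 m - 1 continuations, the value 1 / (\<beta> -
  q) leaves room for exactly the source term 1.\<close>

lemma controlled_carrier:
  assumes "X \<noteq> {}" "\<beta> > 2 * real (card X) - 1"
  shows "controlled x (carrier F) \<beta>"
proof -
  have "card X > 0" using assms finite_X by (simp add: card_gt_0_iff)
  then have [simp]: "real (2 * card X - Suc 0) = 2 * real (card X) - 1" by (simp add: of_nat_diff)
  have "(2 * real (card X) - 1) * g + of_bool P \<le> \<beta> * g"
    if "g = 1 / (\<beta> - (2 * real (card X) - 1))" for g P
  proof -
    have "(\<beta> - (2 * real (card X) - 1)) * g = 1" using assms(2) by (simp add: that)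
    then show ?thesis by (cases P) (auto simp: algebra_simps)
  qed
  note * = this[OF refl]
  show ?thesis unfolding controlled_def
  proof (intro exI[of _ "\<lambda>h a. 1 / (\<beta> - (2 * real (card X) - 1))"]
      exI[of _ "1 / (\<beta> - (2 * real (card X) - 1))"] ballI conjI)
    fix h and a :: "'a letter" assume "a \<in> letters"
    then show "(\<Sum>b\<in>letters - {inv_letter a}. 1 / (\<beta> - (2 * real (card X) - 1))) + of_bool (on_axis x (carrier F) h)
        \<le> \<beta> * (1 / (\<beta> - (2 * real (card X) - 1)))"
      using *[of "on_axis x (carrier F) h"] by (simp only: sum_constant card_letters_Diff) simp
  qed (use assms(2) in auto)
qed

text \<open>Prepending a letter multiplies the sum of \<open>G w (hd w)\<close> over all reduced
  words by at most \<beta>. At elements of \<open>N\<close> the source term gives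
  \<open>\<beta> * G \<ge> 1\<close>, so these sums count them.\<close>

lemma controlled_sphere_le:
  fixes \<beta> :: real
  assumes N: "N \<subseteq> carrier F" "controlled x N \<beta>" "\<beta> > 0"
  shows "\<exists>K>0. \<forall>n. card {g \<in> N. length g = n} \<le> K * \<beta> ^ n"
proof -
  obtain G C where G: "\<And>h a. h \<in> carrier F \<Longrightarrow> a \<in> letters \<Longrightarrow> 0 \<le> G h a \<and> G h a \<le> C \<and>
     (\<Sum>b\<in>letters - {inv_letter a}. G (push_letter b h) b) + of_bool (on_axis x N h) \<le> \<beta> * G h a"
    using N(2) unfolding controlled_def by blast
  have G0: "\<And>h a. h \<in> carrier F \<Longrightarrow> a \<in> letters \<Longrightarrow> 0 \<le> G h a" using G by blast
  \<comment> \<open>Lengths are shifted by one so that every word has a first letter.\<close>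
  define A where "A n = {w \<in> carrier F. length w = Suc n}" for n
  have finA: "finite (A n)" for n using finite_sphere[of "carrier F"] by (simp add: A_def)
  have hd: "hd w \<in> letters" if "w \<in> A n" for w n
    using that by (auto simp: A_def intro!: carrierD(3))
  have A_Suc: "A (Suc n) = (\<lambda>(w, b). b # w) ` (SIGMA w:A n. letters - {inv_letter (hd w)})" for n
  proof (intro equalityI subsetI)
    fix v assume v: "v \<in> A (Suc n)"
    then obtain b w where "v = b # w" by (cases v) (auto simp: A_def)
    moreover from this v have "w \<noteq> []" by (auto simp: A_def)
    ultimately show "v \<in> (\<lambda>(w, b). b # w) ` (SIGMA w:A n. letters - {inv_letter (hd w)})"
      using v by (intro image_eqI[of _ _ "(w, b)"])
        (auto simp: A_def carrier_iff reduced_Cons_iff inv_letter_eq_iff)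
  next
    fix v assume "v \<in> (\<lambda>(w, b). b # w) ` (SIGMA w:A n. letters - {inv_letter (hd w)})"
    then show "v \<in> A (Suc n)"
      by (auto simp: A_def carrier_iff reduced_Cons_iff inv_letter_eq_iff)
  qed
  define K where "K = (\<Sum>w\<in>A 0. G w (hd w))"
  have bound: "(\<Sum>w\<in>A n. G w (hd w)) \<le> K * \<beta> ^ n" for n
  proof (induction n)
    case 0
    then show ?case by (simp add: K_def)
  next
    case (Suc n)
    have "(\<Sum>w\<in>A (Suc n). G w (hd w)) = (\<Sum>(w, b)\<in>(SIGMA w:A n. letters - {inv_letter (hd w)}). G (b # w) b)"
      unfolding A_Suc by (subst sum.reindex) (auto simp: inj_on_def intro!: sum.cong)
    also have "\<dots> = (\<Sum>w\<in>A n. \<Sum>b\<in>letters - {inv_letter (hd w)}. G (b # w) b)"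
      using finA finite_letters by (subst sum.Sigma) auto
    also have "\<dots> \<le> (\<Sum>w\<in>A n. \<beta> * G w (hd w))"
    proof (rule sum_mono)
      fix w assume w: "w \<in> A n"
      then have wF: "w \<in> carrier F" "w \<noteq> []" by (auto simp: A_def)
      have "(\<Sum>b\<in>letters - {inv_letter (hd w)}. G (b # w) b) = (\<Sum>b\<in>letters - {inv_letter (hd w)}. G (push_letter b w) b)"
      proof (intro sum.cong refl)
        fix b assume "b \<in> letters - {inv_letter (hd w)}"
        then have "hd w \<noteq> inv_letter b" by auto
        then have "reduced (b # w)" using wF by (simp add: carrier_iff reduced_Cons_iff)
        then show "G (b # w) b = G (push_letter b w) b" by (simp add: push_letter_reduced)
      qed
      also have "\<dots> \<le> \<beta> * G w (hd w)"
      proof -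
        have "of_bool (on_axis x N w) \<ge> (0 :: real)" by simp
        with G[OF wF(1) hd[OF w]] show ?thesis by linarith
      qed
      finally show "(\<Sum>b\<in>letters - {inv_letter (hd w)}. G (b # w) b) \<le> \<beta> * G w (hd w)" .
    qed
    also have "\<dots> \<le> K * \<beta> ^ Suc n"
      using Suc mult_left_mono[OF Suc, of \<beta>] N(3) by (simp add: sum_distrib_left mult_ac)
    finally show ?case .
  qed
  have K0: "K \<ge> 0" unfolding K_def using G hd by (intro sum_nonneg) (auto simp: A_def)
  \<comment> \<open>The 1 in \<open>K + 1\<close> pays for the empty word at n = 0 and makes the
    constant positive.\<close>
  have "card {g \<in> N. length g = n} \<le> (K + 1) * \<beta> ^ n" for n
  proof (cases n)
    case 0
    have "card {g \<in> N. length g = n} \<le> card {[] :: 'a letter list}"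
      using 0 by (intro card_mono) auto
    with 0 K0 show ?thesis by simp
  next
    case (Suc k)
    have "real (card {g \<in> N. length g = n}) = (\<Sum>w\<in>{g \<in> N. length g = n}. 1)" by simp
    also have "\<dots> \<le> (\<Sum>w\<in>{g \<in> N. length g = n}. \<beta> * G w (hd w))"
    proof (rule sum_mono)
      fix w assume w: "w \<in> {g \<in> N. length g = n}"
      then have wA: "w \<in> A k" using Suc N(1) by (auto simp: A_def)
      then have wF: "w \<in> carrier F" by (simp add: A_def)
      have "on_axis x N w" unfolding on_axis_def using w by (intro exI[of _ 0]) simp
      moreover have "(\<Sum>b\<in>letters - {inv_letter (hd w)}. G (push_letter b w) b) \<ge> 0"
        by (intro sum_nonneg G0 push_closed wF) auto
      ultimately show "1 \<le> \<beta> * G w (hd w)" using G[OF wF hd[OF wA]] by simp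
    qed
    also have "\<dots> \<le> (\<Sum>w\<in>A k. \<beta> * G w (hd w))"
    proof (rule sum_mono2[OF finA])
      show "{g \<in> N. length g = n} \<subseteq> A k" using N(1) Suc by (auto simp: A_def)
      show "0 \<le> \<beta> * G w (hd w)" if "w \<in> A k - {g \<in> N. length g = n}" for w
        using G0[of w "hd w"] hd[of w k] that N(3) by (simp add: A_def)
    qed
    also have "\<dots> \<le> \<beta> * (K * \<beta> ^ k)"
      using bound[of k] N(3) by (simp add: sum_distrib_left[symmetric])
    also have "\<dots> \<le> (K + 1) * \<beta> ^ n" using Suc N(3) by (simp add: algebra_simps)
    finally show ?thesis .
  qed
  then show ?thesis using K0 by (intro exI[of _ "K + 1"]) auto
qed

end

section \<open>The cactus graph\<close>

text \<open>A vertex \<open>(j, [(a\<^sub>1, j\<^sub>1), (a\<^sub>2, j\<^sub>2), \<dots>])\<close> is reached from the root by the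
  word \<open>x^j a\<^sub>1 x^j\<^sub>1 a\<^sub>2 x^j\<^sub>2 \<dots>\<close>, read from right to left; \<open>j < R\<close> is its position on
  its cycle, with \<open>j = 0\<close> for the point nearest to the root and for vertices on no cycle.\<close>

type_synonym 'a cactus_vertex = "nat \<times> ('a letter \<times> nat) list"

locale cycle_cover = finite_basis +
  fixes x :: 'a and M :: "'a letter list set" and R :: nat
  assumes x: "x \<in> X" and M: "subgroup M (free_group X)"
    and R: "R \<ge> 1" and xR: "(push_letter (x, True) ^^ R) [] \<in> M"
begin

abbreviation "pos \<equiv> (x, True)"
abbreviation "neg \<equiv> (x, False)"

lemma pos_neg_letters [simp]: "pos \<in> letters" "neg \<in> letters"
  using x by (auto simp: letters_def)

lemma M_carrier: "m \<in> M \<Longrightarrow> m \<in> carrier F"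
  using subgroup.subset[OF M] by auto

lemma Nil_carrier [simp]: "[] \<in> carrier F"
  using F.one_closed by simp

lemma push_pow_mult:
  "g \<in> carrier F \<Longrightarrow> h \<in> carrier F \<Longrightarrow> (push_letter pos ^^ n) (g \<otimes>\<^bsub>F\<^esub> h) = (push_letter pos ^^ n) g \<otimes>\<^bsub>F\<^esub> h"
  by (induction n) (auto simp: push_mult push_pow_closed)

text \<open>If m = x^n h lies in \<open>M\<close>, then h^-1 x^R h = m^-1 x^R m, because powers of x
  commute.\<close>

lemma push_period:
  assumes "on_axis x M h" "h \<in> carrier F"
  obtains \<nu> where "\<nu> \<in> M" "(push_letter pos ^^ R) h = h \<otimes>\<^bsub>F\<^esub> \<nu>"
proof -
  let ?p = "[pos]"
  have p: "?p \<in> carrier F" by (simp add: letter_closed)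
  obtain n where "(push_letter pos ^^ n) h \<in> M" using assms unfolding on_axis_def by auto
  then have m: "?p [^]\<^bsub>F\<^esub> n \<otimes>\<^bsub>F\<^esub> h \<in> M" using assms by (simp add: push_pow_eq_mult)
  have "?p [^]\<^bsub>F\<^esub> R \<in> M" using xR by (simp add: push_pow_eq_mult p)
  then have "inv\<^bsub>F\<^esub> (?p [^]\<^bsub>F\<^esub> n \<otimes>\<^bsub>F\<^esub> h) \<otimes>\<^bsub>F\<^esub> (?p [^]\<^bsub>F\<^esub> R \<otimes>\<^bsub>F\<^esub> (?p [^]\<^bsub>F\<^esub> n \<otimes>\<^bsub>F\<^esub> h)) \<in> M"
    using subgroup.m_closed[OF M subgroup.m_inv_closed[OF M m] subgroup.m_closed[OF M _ m]] by simp
  moreover have "inv\<^bsub>F\<^esub> (?p [^]\<^bsub>F\<^esub> n \<otimes>\<^bsub>F\<^esub> h) \<otimes>\<^bsub>F\<^esub> (?p [^]\<^bsub>F\<^esub> R \<otimes>\<^bsub>F\<^esub> (?p [^]\<^bsub>F\<^esub> n \<otimes>\<^bsub>F\<^esub> h))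
      = inv\<^bsub>F\<^esub> h \<otimes>\<^bsub>F\<^esub> (?p [^]\<^bsub>F\<^esub> R \<otimes>\<^bsub>F\<^esub> h)"
  proof -
    have "?p [^]\<^bsub>F\<^esub> R \<otimes>\<^bsub>F\<^esub> (?p [^]\<^bsub>F\<^esub> n \<otimes>\<^bsub>F\<^esub> h) = ?p [^]\<^bsub>F\<^esub> n \<otimes>\<^bsub>F\<^esub> (?p [^]\<^bsub>F\<^esub> R \<otimes>\<^bsub>F\<^esub> h)"
      using p assms by (simp add: F.m_assoc[symmetric] F.nat_pow_mult add.commute)
    then show ?thesis using p assms
      by (simp add: F.inv_mult_group F.m_assoc) (simp add: F.m_assoc[symmetric])
  qed
  moreover have "h \<otimes>\<^bsub>F\<^esub> (inv\<^bsub>F\<^esub> h \<otimes>\<^bsub>F\<^esub> (?p [^]\<^bsub>F\<^esub> R \<otimes>\<^bsub>F\<^esub> h)) = (push_letter pos ^^ R) h"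
    using p assms by (simp add: push_pow_eq_mult F.m_assoc[symmetric])
  ultimately show ?thesis using that by metis
qed

lemma on_axis_mult:
  assumes "h \<in> carrier F" "\<nu> \<in> M"
  shows "on_axis x M (h \<otimes>\<^bsub>F\<^esub> \<nu>) \<longleftrightarrow> on_axis x M h"
proof -
  have "(push_letter pos ^^ n) h \<otimes>\<^bsub>F\<^esub> \<nu> \<in> M \<longleftrightarrow> (push_letter pos ^^ n) h \<in> M" for n
  proof
    let ?h = "(push_letter pos ^^ n) h"
    assume "?h \<otimes>\<^bsub>F\<^esub> \<nu> \<in> M"
    then have "?h \<otimes>\<^bsub>F\<^esub> \<nu> \<otimes>\<^bsub>F\<^esub> inv\<^bsub>F\<^esub> \<nu> \<in> M"
      using subgroup.m_closed[OF M _ subgroup.m_inv_closed[OF M assms(2)]] by simp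
    then show "?h \<in> M" using assms M_carrier
      by (simp add: F.m_assoc push_pow_closed )
  qed (use M assms in \<open>auto intro: subgroup.m_closed\<close>)
  then show ?thesis unfolding on_axis_def using assms M_carrier by (simp add: push_pow_mult)
qed

text \<open>Only natural exponents occur in \<open>on_axis\<close>, so passing from h to x h goes
  once round the cycle: x^(n + R - 1) (x h) is x^n h times an element of \<open>M\<close>.\<close>

lemma on_axis_push:
  assumes "h \<in> carrier F"
  shows "on_axis x M (push_letter (x, b) h) \<longleftrightarrow> on_axis x M h"
proof -
  have pos: "on_axis x M (push_letter pos h) \<longleftrightarrow> on_axis x M h" if h: "h \<in> carrier F" for h
  proof
    assume "on_axis x M (push_letter pos h)"
    then obtain n where "(push_letter pos ^^ n) (push_letter pos h) \<in> M" unfolding on_axis_def by auto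
    then show "on_axis x M h" unfolding on_axis_def
      by (intro exI[of _ "Suc n"]) (simp add: funpow_swap1)
  next
    assume on: "on_axis x M h"
    then obtain \<nu> where \<nu>: "\<nu> \<in> M" "(push_letter pos ^^ R) h = h \<otimes>\<^bsub>F\<^esub> \<nu>"
      using push_period h by metis
    obtain n where "(push_letter pos ^^ n) h \<in> M" using on unfolding on_axis_def by auto
    then have "(push_letter pos ^^ n) h \<otimes>\<^bsub>F\<^esub> \<nu> \<in> M" using \<nu> M by (intro subgroup.m_closed)
    then have "(push_letter pos ^^ n) ((push_letter pos ^^ R) h) \<in> M"
      using \<nu> h M_carrier by (simp add: push_pow_mult)
    also have "(push_letter pos ^^ R) h = (push_letter pos ^^ (R - 1)) (push_letter pos h)"
      using R by (metis Suc_diff_1 Suc_le_lessD One_nat_def comp_apply funpow_Suc_right)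
    finally have "(push_letter pos ^^ (n + (R - 1))) (push_letter pos h) \<in> M" by (simp add: funpow_add)
    then show "on_axis x M (push_letter pos h)" unfolding on_axis_def by blast
  qed
  show ?thesis
  proof (cases b)
    case True
    then show ?thesis using pos assms by simp
  next
    case False
    have "push_letter pos (push_letter neg h) = h"
      using push_push_inv[of h pos] assms by (simp add: carrier_iff)
    then show ?thesis using pos[of "push_letter neg h"] False assms by (simp add: push_closed)
  qed
qed

lemma on_axis_push_pow:
  "h \<in> carrier F \<Longrightarrow> on_axis x M ((push_letter pos ^^ n) h) \<longleftrightarrow> on_axis x M h"
  by (induction n) (auto simp: on_axis_push push_pow_closed)

lemma on_axis_M: "m \<in> M \<Longrightarrow> on_axis x M m"
  unfolding on_axis_def by (intro exI[of _ 0]) simp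

lemma on_axis_Nil [simp]: "on_axis x M []"
  using subgroup.one_closed[OF M] on_axis_M by simp

fun base_word :: "('a letter \<times> nat) list \<Rightarrow> 'a letter list" where
  "base_word [] = []"
| "base_word ((a, k) # S) = push_letter a ((push_letter pos ^^ k) (base_word S))"

fun vertex_word :: "'a cactus_vertex \<Rightarrow> 'a letter list" where
  "vertex_word (j, S) = (push_letter pos ^^ j) (base_word S)"

abbreviation "on_cycle S \<equiv> on_axis x M (base_word S)"

text \<open>Normal forms of paths from the root: positive positions exist on cycles only, edges
  labelled x are tree edges only off the cycles, and a path does not turn back at once, which could
  happen only at position 0.\<close>

fun valid_path :: "('a letter \<times> nat) list \<Rightarrow> bool" where
  "valid_path [] \<longleftrightarrow> True"
| "valid_path ((a, k) # S) \<longleftrightarrow> valid_path S \<and> a \<in> letters \<and> k < R \<and> (k > 0 \<longrightarrow> on_cycle S) \<and>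
     (fst a = x \<longrightarrow> \<not> on_cycle S) \<and> (k = 0 \<longrightarrow> S \<noteq> [] \<longrightarrow> fst (hd S) \<noteq> inv_letter a)"

fun valid_vertex :: "'a cactus_vertex \<Rightarrow> bool" where
  "valid_vertex (j, S) \<longleftrightarrow> valid_path S \<and> j < R \<and> (j > 0 \<longrightarrow> on_cycle S)"

text \<open>The term \<open>j + R - 1\<close> is j - 1 modulo R without truncation. A new tree edge
  stores the position \<open>j\<close> at which it leaves, so that turning back restores it.\<close>

fun move :: "'a letter \<Rightarrow> 'a cactus_vertex \<Rightarrow> 'a cactus_vertex" where
  "move b (j, S) =
     (if fst b = x \<and> on_cycle S then ((if snd b then j + 1 else j + R - 1) mod R, S)
      else if j = 0 \<and> S \<noteq> [] \<and> fst (hd S) = inv_letter b then (snd (hd S), tl S)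
      else (0, (b, j) # S))"

lemma base_word_closed: "valid_path S \<Longrightarrow> base_word S \<in> carrier F"
  by (induction S rule: base_word.induct) (auto intro!: push_closed push_pow_closed)

lemma on_cycle_Cons:
  assumes "valid_path S" "fst a = x"
  shows "on_cycle ((a, k) # S) \<longleftrightarrow> on_cycle S"
  using assms on_axis_push[of _ "snd a"]
  by (cases a) (auto simp: on_axis_push_pow base_word_closed push_pow_closed)

lemma valid_move: "b \<in> letters \<Longrightarrow> valid_vertex v \<Longrightarrow> valid_vertex (move b v)"
  using R by (cases v; cases "snd v") (auto split: if_splits)

text \<open>This makes each move a permutation of the valid vertices, so that the free group acts on
  them.\<close>

lemma move_inverse:
  assumes b: "b \<in> letters" and v: "valid_vertex v"
  shows "move (inv_letter b) (move b v) = v"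
proof (cases v)
  case (Pair j S)
  show ?thesis
  proof (cases "fst b = x \<and> on_cycle S")
    case True
    have "((j + 1) mod R + R - 1) mod R = j" "((j + R - 1) mod R + 1) mod R = j" if "j < R"
      using that R by (auto simp: mod_if)
    with True v Pair show ?thesis by (auto simp: inv_letter_def)
  next
    case False
    show ?thesis
    proof (cases "j = 0 \<and> S \<noteq> [] \<and> fst (hd S) = inv_letter b")
      case True
      then obtain k S' where S: "S = (inv_letter b, k) # S'" by (cases S) auto
      have "move b v = (k, S')" using False Pair True S by auto
      with S True v Pair show ?thesis by auto
    next
      case nb: False
      then have "move b v = (0, (b, j) # S)" using False Pair by auto
      \<comment> \<open>A tree edge labelled x starts off the axis and stays off it, so the inverse
        letter turns back instead of rotating.\<close>
      moreover have "\<not> (fst b = x \<and> on_cycle ((b, j) # S))"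
        using False v Pair on_cycle_Cons[of S b j] by auto
      ultimately show ?thesis using Pair by (auto simp del: base_word.simps)
    qed
  qed
qed

text \<open>The cactus covers the Schreier graph of \<open>M\<close>. Equality of cosets is
  expressed through all functions \<open>f\<close> that are invariant under \<open>M\<close> on the
  right; the invariance enters when a rotation wraps round, by \<open>push_period\<close>.\<close>

lemma vertex_word_move:
  assumes b: "b \<in> letters" and v: "valid_vertex v"
    and f: "\<And>h \<nu>. h \<in> carrier F \<Longrightarrow> \<nu> \<in> M \<Longrightarrow> f (h \<otimes>\<^bsub>F\<^esub> \<nu>) = f h"
  shows "f (vertex_word (move b v)) = f (push_letter b (vertex_word v))"
proof -
  obtain j S where vS: "v = (j, S)" by (cases v)
  let ?h = "base_word S"
  have h: "?h \<in> carrier F" and jR: "j < R" using v vS base_word_closed by auto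
  have inv_push: "push_letter (inv_letter a) (push_letter a g) = g"
    "push_letter a (push_letter (inv_letter a) g) = g" if "g \<in> carrier F" for a g
    using push_push_inv[of g "inv_letter a"] push_push_inv[of g a] that by (auto simp: carrier_iff)
  have period: "f ((push_letter pos ^^ R) g) = f g" if "on_axis x M g" "g \<in> carrier F" for g
    using push_period[OF that] f that by metis
  show ?thesis
  proof (cases "fst b = x \<and> on_cycle S")
    case True
    show ?thesis
    proof (cases "snd b")
      case b: True
      then have [simp]: "b = pos" using True by (cases b) auto
      show ?thesis
      proof (cases "j + 1 < R")
        case False
        then have "j + 1 = R" using jR by simp
        then have "push_letter b ((push_letter pos ^^ j) ?h) = (push_letter pos ^^ R) ?h" by auto
        then show ?thesis using \<open>j + 1 = R\<close> period[of ?h] True h by (simp add: vS)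
      qed (use True in \<open>simp add: vS\<close>)
    next
      case b: False
      then have [simp]: "b = neg" using True by (cases b) auto
      show ?thesis
      proof (cases j)
        case 0
        let ?g = "push_letter neg ?h"
        have "(push_letter pos ^^ R) ?g = (push_letter pos ^^ (R - 1)) (push_letter pos ?g)"
          using R by (metis Suc_diff_1 Suc_le_lessD One_nat_def comp_apply funpow_Suc_right)
        also have "push_letter pos ?g = ?h" using inv_push(2)[OF h, of pos] by simp
        finally show ?thesis
          using period[of ?g] True h R 0 on_axis_push[OF h, of False] by (simp add: vS push_closed)
      next
        case (Suc i)
        have "push_letter neg ((push_letter pos ^^ j) ?h) = (push_letter pos ^^ i) ?h"
          using inv_push(1)[OF push_pow_closed[OF _ h], of pos pos i] Suc by simp
        moreover have "(j + R - 1) mod R = i" using Suc jR by simp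
        ultimately show ?thesis using True by (simp add: vS)
      qed
    qed
  next
    case False
    show ?thesis
    proof (cases "j = 0 \<and> S \<noteq> [] \<and> fst (hd S) = inv_letter b")
      case True
      then obtain k S' where S: "S = (inv_letter b, k) # S'" by (cases S) auto
      have "valid_path S'" using v vS S by auto
      then show ?thesis using False True S inv_push(2)[of _ b] by (auto simp: vS push_pow_closed base_word_closed)
    next
      case nb: False
      then have "move b v = (0, (b, j) # S)" using False vS by auto
      then show ?thesis by (simp add: vS)
    qed
  qed
qed

section \<open>The action on the cactus and its kernel\<close>

definition vertex :: "'a letter list \<Rightarrow> 'a cactus_vertex" where
  "vertex h = foldr move h (0, [])"

lemma valid_foldr_move: "set h \<subseteq> letters \<Longrightarrow> valid_vertex v \<Longrightarrow> valid_vertex (foldr move h v)"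
  by (induction h) (auto simp: valid_move simp del: move.simps)

lemma valid_root: "valid_vertex (0, [])"
  using R by simp

lemma valid_vertex_of: "h \<in> carrier F \<Longrightarrow> valid_vertex (vertex h)"
  unfolding vertex_def by (intro valid_foldr_move valid_root) (auto simp: carrier_iff)

lemma foldr_move_push:
  assumes "a \<in> letters" "set h \<subseteq> letters" "valid_vertex v"
  shows "foldr move (push_letter a h) v = move a (foldr move h v)"
proof (cases h)
  case (Cons b w)
  show ?thesis
  proof (cases "b = inv_letter a")
    case True
    have "valid_vertex (foldr move w v)" using assms Cons by (intro valid_foldr_move) auto
    from move_inverse[OF _ this, of b] True assms Cons show ?thesis by (simp del: move.simps)
  qed (simp add: Cons del: move.simps)
qed simp

lemma foldr_move_mult:
  assumes "g \<in> carrier F" "h \<in> carrier F" "valid_vertex v"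
  shows "foldr move (g \<otimes>\<^bsub>F\<^esub> h) v = foldr move g (foldr move h v)"
proof -
  have "foldr move (foldr push_letter g h) v = foldr move g (foldr move h v)" if "set g \<subseteq> letters" for g
    using that
  proof (induction g)
    case (Cons a g)
    have "foldr push_letter g h \<in> carrier F"
      using Cons.prems assms(2) by (induction g) (auto intro: push_closed)
    with Cons show ?case using assms foldr_move_push[of a "foldr push_letter g h" v]
      by (simp add: carrier_iff del: move.simps)
  qed simp
  with assms show ?thesis by (simp add: mult_foldr carrier_iff)
qed

lemma vertex_mult:
  "g \<in> carrier F \<Longrightarrow> h \<in> carrier F \<Longrightarrow> vertex (g \<otimes>\<^bsub>F\<^esub> h) = foldr move g (vertex h)"
  unfolding vertex_def by (intro foldr_move_mult valid_root)

lemma vertex_push: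
  "a \<in> letters \<Longrightarrow> h \<in> carrier F \<Longrightarrow> vertex (push_letter a h) = move a (vertex h)"
  unfolding vertex_def by (intro foldr_move_push valid_root) (auto simp: carrier_iff)

lemma vertex_word_vertex:
  assumes "h \<in> carrier F" and "\<And>h \<nu>. h \<in> carrier F \<Longrightarrow> \<nu> \<in> M \<Longrightarrow> f (h \<otimes>\<^bsub>F\<^esub> \<nu>) = f h"
  shows "f (vertex_word (vertex h)) = f h"
  using assms
proof (induction h arbitrary: f)
  case (Cons b h)
  have h: "h \<in> carrier F" "b \<in> letters" "push_letter b h = b # h"
    using Cons.prems(1) by (auto simp: carrier_iff reduced_Cons_iff push_letter_reduced)
  have "vertex (b # h) = move b (vertex h)" by (simp add: vertex_def)
  then have "f (vertex_word (vertex (b # h))) = f (push_letter b (vertex_word (vertex h)))"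
    using vertex_word_move[OF h(2) valid_vertex_of[OF h(1)], of f] Cons.prems(2) by simp
  also have "\<dots> = f (push_letter b h)"
  \<comment> \<open>Left multiplication by \<open>b\<close> preserves invariance on the right, which
    is why \<open>f\<close> is generalised in the induction.\<close>
  proof (rule Cons.IH[OF h(1), of "\<lambda>g. f (push_letter b g)"])
    fix g \<nu> assume "g \<in> carrier F" "\<nu> \<in> M"
    then show "f (push_letter b (g \<otimes>\<^bsub>F\<^esub> \<nu>)) = f (push_letter b g)"
      using Cons.prems(2)[OF push_closed[OF h(2)]] M_carrier by (simp add: push_mult)
  qed
  finally show ?case using h by simp
qed (simp add: vertex_def)

lemma on_cycle_vertex:
  assumes "h \<in> carrier F"
  shows "on_cycle (snd (vertex h)) \<longleftrightarrow> on_axis x M h"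
proof -
  have "on_axis x M (vertex_word (vertex h)) \<longleftrightarrow> on_cycle (snd (vertex h))"
    using valid_vertex_of[OF assms] by (cases "vertex h") (simp add: on_axis_push_pow base_word_closed)
  then show ?thesis using vertex_word_vertex[OF assms, of "on_axis x M"] on_axis_mult by blast
qed

definition kernel :: "'a letter list set" where
  "kernel = {g \<in> M. \<forall>t\<in>M. vertex (g \<otimes>\<^bsub>F\<^esub> t) = vertex t}"

text \<open>The kernel is the pointwise stabiliser in \<open>M\<close> of the orbit of the root
  under \<open>M\<close>, and \<open>M\<close> permutes this orbit.\<close>

lemma kernel_normal: "kernel \<lhd> F\<lparr>carrier := M\<rparr>"
  unfolding normal_restrict_iff[OF M]
proof (intro conjI ballI)
  show "subgroup kernel F"
  proof (rule F.subgroupI)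
    show "kernel \<subseteq> carrier F" using M_carrier by (auto simp: kernel_def)
    show "kernel \<noteq> {}" using subgroup.one_closed[OF M] F.l_one M_carrier
      by (auto simp: kernel_def intro!: exI[of _ "[]"])
    show "inv\<^bsub>F\<^esub> g \<in> kernel" if "g \<in> kernel" for g
    proof -
      have g: "g \<in> M" "inv\<^bsub>F\<^esub> g \<in> M" "\<And>t. t \<in> M \<Longrightarrow> vertex (g \<otimes>\<^bsub>F\<^esub> t) = vertex t"
        using that M by (auto simp: kernel_def subgroup.m_inv_closed)
      have "vertex (inv\<^bsub>F\<^esub> g \<otimes>\<^bsub>F\<^esub> t) = vertex t" if t: "t \<in> M" for t
        using g(3)[OF subgroup.m_closed[OF M g(2) t]] g t M_carrier
        by (simp add: F.m_assoc[symmetric] )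
      with g show ?thesis by (simp add: kernel_def)
    qed
    show "g \<otimes>\<^bsub>F\<^esub> h \<in> kernel" if "g \<in> kernel" "h \<in> kernel" for g h
      using that M M_carrier by (auto simp: kernel_def F.m_assoc subgroup.m_closed)
  qed
  show "kernel \<subseteq> M" by (auto simp: kernel_def)
  fix g w assume g: "g \<in> M" and w: "w \<in> kernel"
  have ig: "inv\<^bsub>F\<^esub> g \<in> M" and wM: "w \<in> M" using g w M by (auto simp: subgroup.m_inv_closed kernel_def)
  have "vertex (g \<otimes>\<^bsub>F\<^esub> w \<otimes>\<^bsub>F\<^esub> inv\<^bsub>F\<^esub> g \<otimes>\<^bsub>F\<^esub> t) = vertex t" if t: "t \<in> M" for t
  proof -
    have "vertex (g \<otimes>\<^bsub>F\<^esub> w \<otimes>\<^bsub>F\<^esub> inv\<^bsub>F\<^esub> g \<otimes>\<^bsub>F\<^esub> t) = vertex (g \<otimes>\<^bsub>F\<^esub> (w \<otimes>\<^bsub>F\<^esub> (inv\<^bsub>F\<^esub> g \<otimes>\<^bsub>F\<^esub> t)))"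
      using g wM ig t M_carrier by (simp add: F.m_assoc)
    also have "\<dots> = foldr move g (vertex (w \<otimes>\<^bsub>F\<^esub> (inv\<^bsub>F\<^esub> g \<otimes>\<^bsub>F\<^esub> t)))"
      using g wM ig t M_carrier by (intro vertex_mult F.m_closed) auto
    also have "vertex (w \<otimes>\<^bsub>F\<^esub> (inv\<^bsub>F\<^esub> g \<otimes>\<^bsub>F\<^esub> t)) = vertex (inv\<^bsub>F\<^esub> g \<otimes>\<^bsub>F\<^esub> t)"
      using w subgroup.m_closed[OF M ig t] by (simp add: kernel_def)
    also have "foldr move g (vertex (inv\<^bsub>F\<^esub> g \<otimes>\<^bsub>F\<^esub> t)) = vertex (g \<otimes>\<^bsub>F\<^esub> (inv\<^bsub>F\<^esub> g \<otimes>\<^bsub>F\<^esub> t))"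
      using g ig t M_carrier by (intro vertex_mult[symmetric] F.m_closed) auto
    also have "\<dots> = vertex t"
      using g ig t M_carrier by (simp add: F.m_assoc[symmetric])
    finally show ?thesis .
  qed
  then show "g \<otimes>\<^bsub>F\<^esub> w \<otimes>\<^bsub>F\<^esub> inv\<^bsub>F\<^esub> g \<in> kernel"
    using g ig wM M by (simp add: kernel_def subgroup.m_closed)
qed

lemma vertex_kernel: "\<nu> \<in> kernel \<Longrightarrow> vertex \<nu> = (0, [])"
  using subgroup.one_closed[OF M] F.r_one M_carrier by (force simp: kernel_def vertex_def)

lemma vertex_mult_kernel:
  assumes "h \<in> carrier F" "\<nu> \<in> kernel"
  shows "vertex (h \<otimes>\<^bsub>F\<^esub> \<nu>) = vertex h"
proof -
  have "\<nu> \<in> carrier F" using assms(2) M_carrier unfolding kernel_def by blast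
  then have "vertex (h \<otimes>\<^bsub>F\<^esub> \<nu>) = foldr move h (vertex \<nu>)" by (rule vertex_mult[OF assms(1)])
  then show ?thesis unfolding vertex_kernel[OF assms(2)] by (simp only: vertex_def)
qed

lemma move_pos_pow: "on_cycle S \<Longrightarrow> j < R \<Longrightarrow> (move pos ^^ n) (j, S) = ((j + n) mod R, S)"
  by (induction n) (auto simp: mod_Suc_eq)

text \<open>Every vertex reached by a word of \<open>M\<close> lies on a cycle, and R rotations
  bring it back.\<close>

lemma pos_pow_kernel: "(push_letter pos ^^ R) [] \<in> kernel"
proof -
  have "vertex ((push_letter pos ^^ R) [] \<otimes>\<^bsub>F\<^esub> t) = vertex t" if t: "t \<in> M" for t
  proof -
    have tF: "t \<in> carrier F" using t M_carrier by simp
    have "vertex ((push_letter pos ^^ n) t) = (move pos ^^ n) (vertex t)" for n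
      using tF by (induction n) (simp_all add: vertex_push push_pow_closed del: move.simps)
    moreover have "(push_letter pos ^^ R) [] \<otimes>\<^bsub>F\<^esub> t = (push_letter pos ^^ R) t"
      using tF by (simp add: push_pow_mult[symmetric] )
    moreover obtain j S where jS: "vertex t = (j, S)" by (cases "vertex t")
    then have "on_cycle S" "j < R"
      using on_cycle_vertex[OF tF] on_axis_M[OF t] valid_vertex_of[OF tF] by auto
    ultimately show ?thesis using jS move_pos_pow[of S j R] by simp
  qed
  then show ?thesis using xR by (simp add: kernel_def)
qed

text \<open>Elements of the kernel lead to the root, and moves along x stay on the cycle of the
  root. This gives a lower bound for the weight wherever the kernel needs a source term.\<close>

lemma vertex_on_axis_kernel:
  assumes h: "h \<in> carrier F" and on: "on_axis x kernel h"
  shows "snd (vertex h) = []"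
proof -
  obtain n where n: "(push_letter pos ^^ n) h \<in> kernel" using on unfolding on_axis_def by auto
  then have "snd (vertex ((push_letter pos ^^ n) h)) = []" by (simp add: vertex_kernel)
  then show ?thesis
  proof (induction n)
    case (Suc n)
    let ?g = "(push_letter pos ^^ n) h"
    have g: "?g \<in> carrier F" using h by (simp add: push_pow_closed)
    have "snd (move pos (vertex ?g)) = []" using Suc.prems vertex_push[OF _ g, of pos] by simp
    moreover have "vertex ?g = move neg (move pos (vertex ?g))"
      using move_inverse[OF _ valid_vertex_of[OF g], of pos] by simp
    ultimately have "snd (vertex ?g) = []"
      by (cases "move pos (vertex ?g)") (metis move.simps fst_conv on_axis_Nil base_word.simps(1) snd_conv)
    then show ?case using Suc.IH by simp
  qed simp
qed

end

section \<open>Weights on the cactus graph\<close>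

locale weighted_cycle_cover = cycle_cover +
  fixes z :: real
  assumes z: "0 < z" "z < 1"
begin

text \<open>Up to normalisation on each cycle, \<open>weight v\<close> is the sum of \<open>z ^ length \<pi>\<close> over the simple
  paths \<open>\<pi>\<close> from \<open>v\<close> to the root, and \<open>homing v a\<close> is the part of it due to the paths that
  continue a step with letter \<open>a\<close> into \<open>v\<close>.\<close>

definition cycle_weight :: "nat \<Rightarrow> real" where
  "cycle_weight j = (z ^ j + z ^ (R - j)) / (1 + z ^ R)"

fun path_weight :: "('a letter \<times> nat) list \<Rightarrow> real" where
  "path_weight [] = 1"
| "path_weight ((a, k) # S) = z * cycle_weight k * path_weight S"

fun weight :: "'a cactus_vertex \<Rightarrow> real" where
  "weight (j, S) = cycle_weight j * path_weight S"

text \<open>On a cycle a step continues in its own direction only, hence a single power of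
  \<open>z\<close>. The reduction modulo \<open>R\<close> gives exponent 0 at the base point, where
  the cycle may be left. The value 0 stands for a tree edge just taken outwards, as going home would
  turn back.\<close>

fun homing :: "'a cactus_vertex \<Rightarrow> 'a letter \<Rightarrow> real" where
  "homing (j, S) a =
     (if fst a = x \<and> on_cycle S
      then path_weight S * z ^ (if snd a then (R - j) mod R else j) / (1 + z ^ R)
      else if j = 0 \<and> S \<noteq> [] \<and> fst (hd S) = a then 0
      else weight (j, S))"

lemma zR: "0 < z ^ R" "1 + z ^ R > 0"
  using z by (simp_all add: add_pos_pos)

text \<open>The denominator of \<open>cycle_weight\<close> is there for this normalisation, which
  lets weights multiply along a path.\<close>

lemma cycle_weight_0 [simp]: "cycle_weight 0 = 1"
  using zR by (simp add: cycle_weight_def)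

lemma cycle_weight_bounds:
  assumes "j \<le> R"
  shows "z ^ R \<le> cycle_weight j" "0 < cycle_weight j" "cycle_weight j \<le> 1"
proof -
  \<comment> \<open>Expanding this product gives the upper bound 1.\<close>
  have "0 \<le> (1 - z ^ j) * (1 - z ^ (R - j))"
    using z by (intro mult_nonneg_nonneg) (auto intro: power_le_one)
  also have "\<dots> = 1 + z ^ j * z ^ (R - j) - z ^ j - z ^ (R - j)" by (simp add: algebra_simps)
  also have "z ^ j * z ^ (R - j) = z ^ R" using assms by (simp add: power_add[symmetric])
  finally show "cycle_weight j \<le> 1" using zR by (simp add: cycle_weight_def)
  have "z ^ R \<le> z ^ j" "z ^ R \<le> z ^ (R - j)" using z assms by (auto intro!: power_decreasing)
  moreover have "z ^ R * z ^ R \<le> z ^ R" using z by (simp add: mult_left_le_one_le power_le_one)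
  ultimately have "z ^ R * (1 + z ^ R) \<le> z ^ j + z ^ (R - j)" unfolding distrib_left by linarith
  then show "z ^ R \<le> cycle_weight j" using zR by (simp add: cycle_weight_def pos_le_divide_eq)
  with zR show "0 < cycle_weight j" by linarith
qed

lemma path_weight_bounds: "valid_path S \<Longrightarrow> 0 < path_weight S \<and> path_weight S \<le> 1"
proof (induction S rule: path_weight.induct)
  case (2 a k S)
  then have "0 < path_weight S" "path_weight S \<le> 1" "0 < cycle_weight k" "cycle_weight k \<le> 1"
    using cycle_weight_bounds[of k] by auto
  moreover have "z * cycle_weight k * path_weight S \<le> 1 * 1 * 1"
    using calculation z by (intro mult_mono) auto
  ultimately show ?case using z by simp
qed simp

lemma weight_bounds:
  assumes "valid_vertex v"
  shows "0 < weight v" "weight v \<le> 1"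
proof -
  obtain j S where v: "v = (j, S)" by (cases v)
  have "0 < path_weight S" "path_weight S \<le> 1" "0 < cycle_weight j" "cycle_weight j \<le> 1"
    using cycle_weight_bounds[of j] path_weight_bounds[of S] assms v by auto
  then show "0 < weight v" "weight v \<le> 1" using v by (auto intro: mult_le_one)
qed

lemma homing_bounds:
  assumes "valid_vertex v"
  shows "0 \<le> homing v a" "homing v a \<le> 1"
proof -
  obtain j S where v: "v = (j, S)" by (cases v)
  have p: "0 < path_weight S" "path_weight S \<le> 1" using path_weight_bounds[of S] assms v by auto
  have "path_weight S * z ^ n / (1 + z ^ R) \<le> 1" for n
  proof -
    have "path_weight S * z ^ n \<le> 1 * 1" using p z by (intro mult_mono) (auto intro: power_le_one)
    also have "\<dots> \<le> 1 + z ^ R" using zR by simp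
    finally show ?thesis using zR by simp
  qed
  then show "0 \<le> homing v a" "homing v a \<le> 1"
    using p z zR weight_bounds[OF assms] v by (auto simp del: weight.simps)
qed

text \<open>Here \<open>u\<close> and \<open>w\<close> belong to the two ways round the cycle; a
  step lengthens the first and shortens the second.\<close>

lemma cycle_weight_step:
  "(z * u + w) / (1 + z ^ R) = z * ((u + z * w) / (1 + z ^ R)) + (1 - z\<^sup>2) * (w / (1 + z ^ R))"
  using zR(2) by (simp add: divide_simps) (simp add: algebra_simps power2_eq_square)

lemma cycle_weight_succ:
  assumes "j < R"
  shows "cycle_weight ((j + 1) mod R) = z * cycle_weight j + (1 - z\<^sup>2) * (z ^ (R - 1 - j) / (1 + z ^ R))"
proof -
  have "cycle_weight ((j + 1) mod R) = cycle_weight (j + 1)"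
  proof (cases "j + 1 < R")
    case False
    then have "j + 1 = R" using assms by simp
    then show ?thesis using zR by (simp add: cycle_weight_def)
  qed simp
  also have "\<dots> = (z * z ^ j + z ^ (R - 1 - j)) / (1 + z ^ R)" by (simp add: cycle_weight_def)
  also have "R - j = Suc (R - 1 - j)" using assms by simp
  then have "cycle_weight j = (z ^ j + z * z ^ (R - 1 - j)) / (1 + z ^ R)" by (simp add: cycle_weight_def)
  ultimately show ?thesis by (simp only: cycle_weight_step)
qed

lemma cycle_weight_pred:
  assumes "j < R"
  shows "cycle_weight ((j + R - 1) mod R) = z * cycle_weight j + (1 - z\<^sup>2) * (z ^ ((j + R - 1) mod R) / (1 + z ^ R))"
proof (cases j)
  case 0
  have "R - (R - 1) = 1" "Suc (R - 1) = R" using R by auto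
  then have "cycle_weight (R - 1) = (z * 1 + z ^ (R - 1)) / (1 + z ^ R)"
    "cycle_weight 0 = (1 + z * z ^ (R - 1)) / (1 + z ^ R)"
    by (simp_all add: cycle_weight_def flip: power_Suc)
  moreover have "(j + R - 1) mod R = R - 1" using 0 R by simp
  ultimately show ?thesis unfolding 0 by (simp only: cycle_weight_step)
next
  case (Suc i)
  then have m: "(j + R - 1) mod R = i" using assms by simp
  have "R - i = Suc (R - j)" using Suc assms by simp
  then have "cycle_weight i = (z * z ^ (R - j) + z ^ i) / (1 + z ^ R)"
    "cycle_weight j = (z ^ (R - j) + z * z ^ i) / (1 + z ^ R)"
    using Suc by (simp_all add: cycle_weight_def add.commute)
  then show ?thesis unfolding m by (simp only: cycle_weight_step)
qed

text \<open>The cases of \<open>move\<close> are written as a sum of three terms, each tied to a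
  single letter, so that the sum over all letters can be evaluated.\<close>

lemma homing_move:
  assumes b: "b \<in> letters" and v: "valid_vertex (j, S)"
  shows "homing (move b (j, S)) b =
    (if on_cycle S \<and> b = pos then path_weight S * (z ^ (R - 1 - j) / (1 + z ^ R)) else 0) +
    (if on_cycle S \<and> b = neg then path_weight S * (z ^ ((j + R - 1) mod R) / (1 + z ^ R)) else 0) +
    (if j = 0 \<and> S \<noteq> [] \<and> b = inv_letter (fst (hd S)) then path_weight S / z else 0)"
proof -
  \<comment> \<open>A tree edge labelled x into a cycle would, by \<open>on_cycle_Cons\<close>,
    start on a cycle as well, against validity. So a rotation and a turn back never share a
    letter.\<close>
  have top: "fst (fst (hd S)) \<noteq> x" if "on_cycle S" "S \<noteq> []"
    using that v on_cycle_Cons by (cases S) auto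
  show ?thesis
  proof (cases "fst b = x \<and> on_cycle S")
    case True
    then have nt: "\<not> (S \<noteq> [] \<and> b = inv_letter (fst (hd S)))" using top by auto
    show ?thesis
    proof (cases "snd b")
      case b: True
      then have "b = pos" using True by (cases b) auto
      moreover have "(R - (j + 1) mod R) mod R = R - 1 - j"
      proof (cases "j + 1 < R")
        case False
        then have "j + 1 = R" using v by simp
        then show ?thesis by simp
      qed simp
      ultimately show ?thesis using True nt by auto
    next
      case b: False
      then have "b = neg" using True by (cases b) auto
      then show ?thesis using True nt by auto
    qed
  next
    case False
    then have nc: "\<not> (on_cycle S \<and> b = pos)" "\<not> (on_cycle S \<and> b = neg)" by auto
    show ?thesis
    proof (cases "j = 0 \<and> S \<noteq> [] \<and> fst (hd S) = inv_letter b")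
      case True
      then obtain k S' where S: "S = (inv_letter b, k) # S'" by (cases S) auto
      have "fst b = x \<longrightarrow> \<not> on_cycle S'" "k = 0 \<longrightarrow> S' \<noteq> [] \<longrightarrow> fst (hd S') \<noteq> b"
        using v S by simp_all
      \<comment> \<open>Validity excludes both special cases of \<open>homing\<close> after a step
        back, so the full weight counts.\<close>
      then have nh: "\<not> (fst b = x \<and> on_cycle S')" "\<not> (k = 0 \<and> S' \<noteq> [] \<and> fst (hd S') = b)" by blast+
      have "homing (k, S') b = weight (k, S')"
        unfolding homing.simps if_not_P[OF nh(1)] if_not_P[OF nh(2)] ..
      moreover have "path_weight S / z = weight (k, S')" using S z by simp
      moreover have "move b (j, S) = (k, S')" using False True S by auto
      moreover have c: "j = 0 \<and> S \<noteq> [] \<and> b = inv_letter (fst (hd S))" using True by auto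
      ultimately show ?thesis unfolding if_not_P[OF nc(1)] if_not_P[OF nc(2)] if_P[OF c] by simp
    next
      case nb: False
      then have mv: "move b (j, S) = (0, (b, j) # S)" using False by auto
      moreover have nh: "\<not> (fst b = x \<and> on_cycle ((b, j) # S))"
        using False v on_cycle_Cons[of S b j] by auto
      then have "homing (0, (b, j) # S) b = 0" unfolding homing.simps if_not_P[OF nh] by simp
      moreover have c: "\<not> (j = 0 \<and> S \<noteq> [] \<and> b = inv_letter (fst (hd S)))" using nb by auto
      ultimately show ?thesis unfolding mv if_not_P[OF nc(1)] if_not_P[OF nc(2)] if_not_P[OF c] by simp
    qed
  qed
qed

text \<open>A step multiplies the contribution of the paths it lengthens by z and that of the paths
  it shortens by 1 / z. The latter become the new homing part, and 1 / z = z + (1 - z^2) /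
  z.\<close>

lemma weight_move:
  assumes b: "b \<in> letters" and v: "valid_vertex v"
  shows "weight (move b v) = z * weight v + (1 - z\<^sup>2) * homing (move b v) b"
proof -
  obtain j S where vS: "v = (j, S)" by (cases v)
  have vj: "valid_vertex (j, S)" using v vS by simp
  then have j: "j < R" by simp
  note hm = homing_move[OF b vj]
  show ?thesis unfolding vS
  proof (cases "fst b = x \<and> on_cycle S")
    case True
    then have nt: "\<not> (S \<noteq> [] \<and> b = inv_letter (fst (hd S)))"
      using vj on_cycle_Cons by (cases S) auto
    show "weight (move b (j, S)) = z * weight (j, S) + (1 - z\<^sup>2) * homing (move b (j, S)) b"
    proof (cases "snd b")
      case sb: True
      then have [simp]: "b = pos" using True by (cases b) auto
      have "homing (move b (j, S)) b = path_weight S * (z ^ (R - 1 - j) / (1 + z ^ R))"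
        unfolding hm using True nt by auto
      moreover have "weight (move b (j, S)) = cycle_weight ((j + 1) mod R) * path_weight S" using True by simp
      ultimately show ?thesis unfolding cycle_weight_succ[OF j] by (simp only: weight.simps algebra_simps)
    next
      case sb: False
      then have [simp]: "b = neg" using True by (cases b) auto
      have "homing (move b (j, S)) b = path_weight S * (z ^ ((j + R - 1) mod R) / (1 + z ^ R))"
        unfolding hm using True nt by auto
      moreover have "weight (move b (j, S)) = cycle_weight ((j + R - 1) mod R) * path_weight S" using True by simp
      ultimately show ?thesis unfolding cycle_weight_pred[OF j] by (simp only: weight.simps algebra_simps)
    qed
  next
    case False
    then have nc: "\<not> (on_cycle S \<and> b = pos)" "\<not> (on_cycle S \<and> b = neg)" by auto
    show "weight (move b (j, S)) = z * weight (j, S) + (1 - z\<^sup>2) * homing (move b (j, S)) b"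
    proof (cases "j = 0 \<and> S \<noteq> [] \<and> fst (hd S) = inv_letter b")
      case True
      then have c: "j = 0 \<and> S \<noteq> [] \<and> b = inv_letter (fst (hd S))" by auto
      have "homing (move b (j, S)) b = path_weight S / z"
        unfolding hm if_not_P[OF nc(1)] if_not_P[OF nc(2)] if_P[OF c] by simp
      moreover obtain k S' where S: "S = (inv_letter b, k) # S'" using True by (cases S) auto
      then have "weight (move b (j, S)) = path_weight S / z" using False True z by auto
      moreover have "weight (j, S) = path_weight S" using True by simp
      moreover have "path_weight S / z = z * path_weight S + (1 - z\<^sup>2) * (path_weight S / z)"
        using z by (simp add: field_simps power2_eq_square)
      ultimately show ?thesis by (simp only:)
    next
      case nb: False
      then have c: "\<not> (j = 0 \<and> S \<noteq> [] \<and> b = inv_letter (fst (hd S)))" by auto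
      have "homing (move b (j, S)) b = 0"
        unfolding hm if_not_P[OF nc(1)] if_not_P[OF nc(2)] if_not_P[OF c] by simp
      moreover have "move b (j, S) = (0, (b, j) # S)" using nb False by auto
      ultimately show ?thesis by (simp del: move.simps)
    qed
  qed
qed

text \<open>Continuing towards the root passes the homing part on with factor 1 / z. The factor 1 +
  z^R makes up for the normalisation when a step along the cycle arrives at its base point. From
  there, each detour round the whole cycle costs at most
  \<open>z ^ (R - 1) * weight v\<close>.\<close>

lemma sum_homing_le:
  assumes a: "a \<in> letters" and v: "valid_vertex v"
  shows "(\<Sum>b\<in>letters - {inv_letter a}. homing (move b v) b) \<le>
    (1 + z ^ R) / z * homing v a + 2 * z ^ (R - 1) * weight v * of_bool (on_cycle (snd v))"
proof -
  obtain j S where vS: "v = (j, S)" by (cases v)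
  have vj: "valid_vertex (j, S)" using v vS by simp
  then have j: "j < R" by simp
  have top: "fst (fst (hd S)) \<noteq> x" if "on_cycle S" "S \<noteq> []"
    using that vj on_cycle_Cons by (cases S) auto
  define p where "p = path_weight S"
  have p: "p > 0" using path_weight_bounds[of S] vj by (simp add: p_def)
  \<comment> \<open>These are the homing parts after a step x and a step x^-1 on the cycle; the step
    back over the tree edge contributes \<open>p / z\<close>.\<close>
  define e1 where "e1 = p * (z ^ (R - 1 - j) / (1 + z ^ R))"
  define e2 where "e2 = p * (z ^ ((j + R - 1) mod R) / (1 + z ^ R))"
  define H where "H = (1 + z ^ R) / z * homing v a"
  define Z where "Z = z ^ (R - 1) * weight v"
  define A where "A = letters - {inv_letter a}"
  have finA: "finite A" using finite_letters by (simp add: A_def)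
  have hdS: "inv_letter (fst (hd S)) \<in> letters" if "S \<noteq> []" using that vj by (cases S) auto
  have inA: "pos \<in> A \<longleftrightarrow> a \<noteq> neg" "neg \<in> A \<longleftrightarrow> a \<noteq> pos"
    by (cases a; auto simp: A_def)+
  have inA_top: "inv_letter (fst (hd S)) \<in> A \<longleftrightarrow> a \<noteq> fst (hd S)" if "S \<noteq> []"
    using hdS[OF that] by (auto simp: A_def inv_letter_eq_iff)
  have "(\<Sum>b\<in>A. homing (move b v) b) =
      (\<Sum>b\<in>A. (if b = pos then of_bool (on_cycle S) * e1 else 0) + (if b = neg then of_bool (on_cycle S) * e2 else 0)
        + (if b = inv_letter (fst (hd S)) then of_bool (j = 0 \<and> S \<noteq> []) * (p / z) else 0))"
    using homing_move[OF _ vj] by (intro sum.cong refl) (auto simp: A_def vS e1_def e2_def p_def)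
  also have "\<dots> = of_bool (on_cycle S \<and> a \<noteq> neg) * e1 + of_bool (on_cycle S \<and> a \<noteq> pos) * e2
      + of_bool (j = 0 \<and> S \<noteq> [] \<and> a \<noteq> fst (hd S)) * (p / z)"
    using inA inA_top finA by (simp add: sum.distrib) (auto simp: of_bool_def)
  also have "\<dots> \<le> H + 2 * Z * of_bool (on_cycle S)"
  proof -
    have wv: "weight v = cycle_weight j * p" "weight v > 0" using weight_bounds[OF v] by (simp_all add: vS p_def)
    have hpos: "0 \<le> homing v a" by (rule homing_bounds[OF v])
    have Z0: "0 \<le> Z" using wv z by (simp add: Z_def)
    have H0: "0 \<le> H" using hpos zR z by (simp add: H_def)
    have div: "homing v a / z \<le> H"
      using hpos z zR by (simp add: H_def divide_right_mono mult_right_mono algebra_simps divide_simps)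
    have small: "p * (z ^ n / (1 + z ^ R)) \<le> z ^ n * p" for n
      using p zR z by (simp add: divide_simps mult_left_mono algebra_simps)
    show ?thesis
    proof (cases "fst a = x \<and> on_cycle S")
      case ax: True
      have nt: "j = 0 \<Longrightarrow> homing v a = p / (1 + z ^ R)" using ax by (simp add: vS p_def)
      show ?thesis
      proof (cases "snd a")
        case True
        then have a: "a = pos" using ax by (cases a) auto
        show ?thesis
        proof (cases "j = 0")
          case True
          have "e1 \<le> Z" using wv small[of "R - 1"] True by (simp add: e1_def Z_def)
          moreover have "H = p / z" using nt[OF True] zR z by (simp add: H_def)
          moreover have "weight v = p" using wv True by simp
          moreover have "0 < p / z" using p z by simp
          ultimately show ?thesis using Z0 a ax True by (auto simp: of_bool_def)
        next
          case False
          have "R - j = Suc (R - 1 - j)" using j by simp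
          then have "homing v a / z = e1" using False a ax z j by (simp add: vS p_def e1_def)
          then show ?thesis using div Z0 False a ax by (auto simp: of_bool_def)
        qed
      next
        case sa: False
        then have a: "a = neg" using ax by (cases a) auto
        show ?thesis
        proof (cases j)
          case 0
          have "e2 \<le> Z" using wv small[of "R - 1"] 0 R by (simp add: e2_def Z_def)
          moreover have "H = p / z" using nt[OF 0] zR z by (simp add: H_def)
          moreover have "weight v = p" using wv 0 by simp
          moreover have "0 < p / z" using p z by simp
          ultimately show ?thesis using Z0 a ax 0 by (auto simp: of_bool_def)
        next
          case (Suc i)
          then have "(j + R - 1) mod R = i" using j by simp
          then have "homing v a / z = e2" using Suc a ax z by (simp add: vS p_def e2_def)
          then show ?thesis using div Z0 Suc a ax by (auto simp: of_bool_def)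
        qed
      qed
    next
      case nax: False
      show ?thesis
      proof (cases "on_cycle S")
        case True
        then have a: "a \<noteq> pos" "a \<noteq> neg" using nax by auto
        show ?thesis
        proof (cases j)
          case 0
          have e: "e1 \<le> Z" "e2 \<le> Z"
            using wv small[of "R - 1"] 0 R by (simp_all add: e1_def e2_def Z_def)
          have w: "weight v = p" using wv 0 by simp
          show ?thesis
          proof (cases "S \<noteq> [] \<and> a \<noteq> fst (hd S)")
            case True
            then have "homing v a = p" using nax 0 w by (auto simp: vS)
            then show ?thesis using e Z0 w div H0 \<open>on_cycle S\<close> a 0 by (auto simp: of_bool_def)
          next
            case False
            then show ?thesis using e Z0 w H0 \<open>on_cycle S\<close> a 0 by (auto simp: of_bool_def)
          qed
        next
          case (Suc i)
          then have i: "(j + R - 1) mod R = i" using j by simp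
          have "R - j = Suc (R - 1 - j)" using j by simp
          then have "cycle_weight j = z * ((z ^ i + z ^ (R - 1 - j)) / (1 + z ^ R))"
            using Suc by (simp add: cycle_weight_def distrib_left add_divide_distrib)
          \<comment> \<open>A path that enters a cycle away from its base point may go home either
            way round, and the two parts add up exactly to the weight divided by z.\<close>
          then have "weight v / z = p * ((z ^ i + z ^ (R - 1 - j)) / (1 + z ^ R))" using z by (simp add: wv)
          also have "\<dots> = e1 + e2" unfolding e1_def e2_def i by (simp only: add_divide_distrib distrib_left add.commute)
          finally have "weight v / z = e1 + e2" .
          moreover have "homing v a = weight v" using nax Suc by (auto simp: vS)
          ultimately show ?thesis using div Z0 True Suc a by (auto simp: of_bool_def)
        qed
      next
        case False
        then have j0: "j = 0" using vj by auto
        have w: "weight v = p" using wv j0 by simp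
        show ?thesis
        proof (cases "S \<noteq> [] \<and> a \<noteq> fst (hd S)")
          case True
          then have "homing v a = p" using nax j0 w by (auto simp: vS)
          then show ?thesis using div H0 False by (auto simp: of_bool_def)
        next
          case nt: False
          then show ?thesis using H0 False j0 by (auto simp: of_bool_def)
        qed
      qed
    qed
  qed
  finally show ?thesis by (simp add: A_def vS H_def Z_def)
qed

text \<open>The new supersolution is \<open>\<phi>\<close>, that is, \<delta> times weight times
  \<open>G\<close>, plus the homing part. The first term is passed on with factor z \<beta> = 1 / z,
  and by \<open>weight_move\<close> produces a small multiple of the homing part; the second has
  factor about 1 / z by \<open>sum_homing_le\<close>. The detours round cycles are paid for by the
  source term of \<open>G\<close>, which is present exactly on the cycles.\<close>

lemma controlled_kernel:
  assumes \<beta>: "\<beta> * z\<^sup>2 = 1" and \<delta>: "\<delta> > 0" and \<mu>: "\<mu> < \<rho>"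
    and G: "\<And>h a. h \<in> carrier F \<Longrightarrow> a \<in> letters \<Longrightarrow> 0 \<le> G h a"
      "\<And>h a. h \<in> carrier F \<Longrightarrow> a \<in> letters \<Longrightarrow> G h a \<le> C"
      "\<And>h a \<nu>. h \<in> carrier F \<Longrightarrow> a \<in> letters \<Longrightarrow> \<nu> \<in> M \<Longrightarrow> G (h \<otimes>\<^bsub>F\<^esub> \<nu>) a = G h a"
      "\<And>h a. h \<in> carrier F \<Longrightarrow> a \<in> letters \<Longrightarrow>
        (\<Sum>b\<in>letters - {inv_letter a}. G (push_letter b h) b) + of_bool (on_axis x M h) \<le> \<beta> * G h a"
    and small: "(1 + \<delta> * C) * ((1 + z ^ R) / z) \<le> \<mu>" "(1 + \<delta> * C) * (2 * z ^ (R - 1)) \<le> \<delta> * z"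
  shows "controlled x kernel \<rho>"
proof -
  have C: "C \<ge> 0" using G(1)[of "[]" pos] G(2)[of "[]" pos] by simp
  define \<phi> where "\<phi> h a = \<delta> * weight (vertex h) * G h a + homing (vertex h) a" for h a
  have super: "(\<Sum>b\<in>letters - {inv_letter a}. \<phi> (push_letter b h) b) \<le> \<mu> * \<phi> h a"
    if h: "h \<in> carrier F" and a: "a \<in> letters" for h a
  proof -
    let ?v = "vertex h" and ?A = "letters - {inv_letter a}"
    let ?w = "weight ?v" and ?o = "of_bool (on_axis x M h) :: real"
    have v: "valid_vertex ?v" by (rule valid_vertex_of[OF h])
    have w: "?w > 0" and o: "?o \<ge> 0" using weight_bounds[OF v] by simp_all
    have "\<phi> (push_letter b h) b \<le> \<delta> * z * ?w * G (push_letter b h) b + (1 + \<delta> * C) * homing (move b ?v) b"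
      if "b \<in> ?A" for b
    proof -
      have b: "b \<in> letters" using that by simp
      let ?g = "G (push_letter b h) b" and ?i = "homing (move b ?v) b"
      have g: "0 \<le> ?g" "?g \<le> C" using G(1,2)[OF push_closed[OF b h] b] by auto
      have i: "0 \<le> ?i" by (rule homing_bounds[OF valid_move[OF b v]])
      have z2: "0 \<le> 1 - z\<^sup>2" "1 - z\<^sup>2 \<le> 1" using z by (auto simp: power_le_one)
      have "\<phi> (push_letter b h) b = \<delta> * (z * ?w + (1 - z\<^sup>2) * ?i) * ?g + ?i"
        unfolding \<phi>_def vertex_push[OF b h] weight_move[OF b v] ..
      also have "\<dots> = \<delta> * z * ?w * ?g + (1 + \<delta> * ((1 - z\<^sup>2) * ?g)) * ?i" by (simp add: algebra_simps)
      also have "\<dots> \<le> \<delta> * z * ?w * ?g + (1 + \<delta> * (1 * C)) * ?i"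
        using g z2 \<delta> i C by (intro add_left_mono mult_right_mono mult_left_mono mult_mono) auto
      finally show ?thesis by simp
    qed
    then have "(\<Sum>b\<in>?A. \<phi> (push_letter b h) b) \<le>
        (\<Sum>b\<in>?A. \<delta> * z * ?w * G (push_letter b h) b + (1 + \<delta> * C) * homing (move b ?v) b)"
      by (rule sum_mono)
    also have "\<dots> = \<delta> * z * ?w * (\<Sum>b\<in>?A. G (push_letter b h) b) + (1 + \<delta> * C) * (\<Sum>b\<in>?A. homing (move b ?v) b)"
      by (simp only: sum.distrib sum_distrib_left)
    also have "\<dots> \<le> \<delta> * z * ?w * (\<beta> * G h a - ?o) +
        (1 + \<delta> * C) * ((1 + z ^ R) / z * homing ?v a + 2 * z ^ (R - 1) * ?w * ?o)"
    proof (intro add_mono mult_left_mono)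
      show "(\<Sum>b\<in>?A. G (push_letter b h) b) \<le> \<beta> * G h a - ?o" using G(4)[OF h a] by linarith
      show "(\<Sum>b\<in>?A. homing (move b ?v) b) \<le> (1 + z ^ R) / z * homing ?v a + 2 * z ^ (R - 1) * ?w * ?o"
        using sum_homing_le[OF a v] on_cycle_vertex[OF h] by simp
    qed (use w \<delta> z C in auto)
    \<comment> \<open>The last bracket balances the detours against the source term of
      \<open>G\<close>; it is nonpositive by the second smallness assumption.\<close>
    also have "\<dots> = (z * \<beta>) * (\<delta> * ?w * G h a) + (1 + \<delta> * C) * ((1 + z ^ R) / z) * homing ?v a
        + ((1 + \<delta> * C) * (2 * z ^ (R - 1)) - \<delta> * z) * (?w * ?o)"
      by (simp add: algebra_simps)
    also have "\<dots> \<le> \<mu> * (\<delta> * ?w * G h a) + \<mu> * homing ?v a + 0"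
    proof (intro add_mono mult_right_mono)
      have "z * (z * \<beta>) = 1" using \<beta> by (simp add: power2_eq_square mult_ac)
      then have "z * \<beta> = 1 / z" using z by (simp add: field_simps)
      also have "\<dots> \<le> 1 * ((1 + z ^ R) / z)" using z zR by (simp add: divide_right_mono)
      also have "\<dots> \<le> (1 + \<delta> * C) * ((1 + z ^ R) / z)"
        using \<delta> C z zR by (intro mult_right_mono) auto
      finally show "z * \<beta> \<le> \<mu>" using small(1) by linarith
      show "((1 + \<delta> * C) * (2 * z ^ (R - 1)) - \<delta> * z) * (?w * ?o) \<le> 0"
        using small(2) w o by (intro mult_nonpos_nonneg) auto
      show "0 \<le> \<delta> * ?w * G h a" using \<delta> w G(1)[OF h a] by simp
      show "0 \<le> homing ?v a" by (rule homing_bounds[OF v])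
    qed (rule small(1))
    finally show ?thesis by (simp add: \<phi>_def distrib_left)
  qed
  have \<phi>0: "0 \<le> \<phi> h a" and \<phi>1: "\<phi> h a \<le> \<delta> * C + 1" if h: "h \<in> carrier F" "a \<in> letters" for h a
  proof -
    have b: "0 < weight (vertex h)" "weight (vertex h) \<le> 1" "0 \<le> homing (vertex h) a" "homing (vertex h) a \<le> 1"
      using weight_bounds homing_bounds valid_vertex_of[OF h(1)] by auto
    show "0 \<le> \<phi> h a" using b \<delta> G(1)[OF h] by (simp add: \<phi>_def)
    have "\<delta> * (weight (vertex h) * G h a) \<le> \<delta> * (1 * C)"
      using b \<delta> G(1,2)[OF h] by (intro mult_left_mono mult_mono) auto
    with b show "\<phi> h a \<le> \<delta> * C + 1" by (simp add: \<phi>_def mult.assoc)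
  qed
  \<comment> \<open>On the axis of the kernel the weight is at least \<open>z ^ R\<close>, and the
    source term of \<open>G\<close> gives \<open>G \<ge> 1 / \<beta> = z\<^sup>2\<close>.\<close>
  define c where "c = \<delta> * z ^ R * z\<^sup>2"
  have c: "c > 0" using \<delta> z by (simp add: c_def)
  have lower: "c \<le> \<phi> h a" if h: "h \<in> carrier F" and a: "a \<in> letters" and on: "on_axis x kernel h" for h a
  proof -
    obtain j where j: "vertex h = (j, [])" using vertex_on_axis_kernel[OF h on] by (cases "vertex h") auto
    then have wR: "z ^ R \<le> weight (vertex h)"
      using valid_vertex_of[OF h] cycle_weight_bounds(1)[of j] by simp
    have "on_axis x M h" using on by (auto simp: on_axis_def kernel_def)
    then have "1 \<le> \<beta> * G h a"
      using G(4)[OF h a] sum_nonneg[of "letters - {inv_letter a}" "\<lambda>b. G (push_letter b h) b"]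
        G(1) push_closed[OF _ h] by fastforce
    then have "z\<^sup>2 * 1 \<le> z\<^sup>2 * (\<beta> * G h a)" by (intro mult_left_mono) auto
    also have "z\<^sup>2 * (\<beta> * G h a) = (\<beta> * z\<^sup>2) * G h a" by (simp only: mult_ac)
    finally have "z\<^sup>2 \<le> G h a" unfolding \<beta> by simp
    from mult_mono[OF wR this] have "z ^ R * z\<^sup>2 \<le> weight (vertex h) * G h a"
      using weight_bounds(1)[OF valid_vertex_of[OF h]] by simp
    then have "\<delta> * (z ^ R * z\<^sup>2) \<le> \<delta> * (weight (vertex h) * G h a)" using \<delta> by (intro mult_left_mono) auto
    moreover have "0 \<le> homing (vertex h) a" by (rule homing_bounds[OF valid_vertex_of[OF h]])
    ultimately show ?thesis by (simp add: \<phi>_def c_def mult.assoc)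
  qed
  \<comment> \<open>The margin between \<mu> and \<rho> yields a source term of at least
    \<open>K\<close>, and division by \<open>K\<close> makes it 1.\<close>
  define K where "K = (\<rho> - \<mu>) * c"
  have K: "K > 0" using \<mu> c by (simp add: K_def)
  show ?thesis unfolding controlled_def
  proof (intro exI[of _ "\<lambda>h a. \<phi> h a / K"] exI[of _ "(\<delta> * C + 1) / K"] ballI conjI)
    fix h a assume h: "h \<in> carrier F" "a \<in> letters"
    show "0 \<le> \<phi> h a / K" "\<phi> h a / K \<le> (\<delta> * C + 1) / K"
      using \<phi>0[OF h] \<phi>1[OF h] K by (auto intro: divide_right_mono)
    show "\<phi> (h \<otimes>\<^bsub>F\<^esub> \<nu>) a / K = \<phi> h a / K" if "\<nu> \<in> kernel" for \<nu>
      using vertex_mult_kernel[OF h(1) that] G(3)[OF h] that by (simp add: \<phi>_def kernel_def)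
    have "K * of_bool (on_axis x kernel h) \<le> (\<rho> - \<mu>) * \<phi> h a"
      using lower[OF h] \<phi>0[OF h] \<mu> by (auto simp: K_def)
    with super[OF h]
    have "(\<Sum>b\<in>letters - {inv_letter a}. \<phi> (push_letter b h) b) + K * of_bool (on_axis x kernel h) \<le> \<rho> * \<phi> h a"
      by (simp add: algebra_simps)
    then have "((\<Sum>b\<in>letters - {inv_letter a}. \<phi> (push_letter b h) b) + K * of_bool (on_axis x kernel h)) / K
        \<le> \<rho> * \<phi> h a / K" using K by (intro divide_right_mono) auto
    then show "(\<Sum>b\<in>letters - {inv_letter a}. \<phi> (push_letter b h) b / K) + of_bool (on_axis x kernel h) \<le> \<rho> * (\<phi> h a / K)"
      using K by (simp add: add_divide_distrib sum_divide_distrib)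
  qed
qed

end

section \<open>Choice of the cycle length and descent along the chain\<close>

context finite_basis
begin

lemma push_pow_mult_mem:
  assumes a: "a \<in> letters" and M: "subgroup M F" and R: "(push_letter a ^^ R) [] \<in> M"
  shows "(push_letter a ^^ (R * k)) [] \<in> M"
proof (induction k)
  case 0
  then show ?case using subgroup.one_closed[OF M] by simp
next
  case (Suc k)
  have e: "[] \<in> carrier F" using F.one_closed by simp
  have "[a] [^]\<^bsub>F\<^esub> R \<in> M" using R push_pow_eq_mult[OF a e, of R] letter_closed[OF a] by simp
  moreover have "(push_letter a ^^ (R * Suc k)) [] = [a] [^]\<^bsub>F\<^esub> R \<otimes>\<^bsub>F\<^esub> (push_letter a ^^ (R * k)) []"
    using push_pow_eq_mult[OF a push_pow_closed[OF a e]] by (simp add: funpow_add)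
  ultimately show ?case using subgroup.m_closed[OF M] Suc.IH by simp
qed

lemma push_pow_Nil: "(push_letter a ^^ n) [] = replicate n a"
proof (induction n)
  case (Suc n)
  then show ?case by (cases n) auto
qed simp

text \<open>The parameters are fixed in the order z, \<mu>, \<delta>, R: first \<delta> is made
  small in terms of the bound \<open>C\<close>, then R is taken as a large multiple of
  \<open>R0\<close>.\<close>

lemma ex_controlled_normal:
  assumes x: "x \<in> X" and M: "subgroup M F" and R0: "R0 \<ge> 1" "(push_letter (x, True) ^^ R0) [] \<in> M"
    and ctl: "controlled x M \<beta>" and \<beta>: "\<beta> > 1" "sqrt \<beta> < \<rho>"
  shows "\<exists>N R. R \<ge> 1 \<and> (push_letter (x, True) ^^ R) [] \<in> N \<and> N \<lhd> F\<lparr>carrier := M\<rparr> \<and> controlled x N \<rho>"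
proof -
  obtain G C where G: "\<And>h a. h \<in> carrier F \<Longrightarrow> a \<in> letters \<Longrightarrow> 0 \<le> G h a"
      "\<And>h a. h \<in> carrier F \<Longrightarrow> a \<in> letters \<Longrightarrow> G h a \<le> C"
      "\<And>h a \<nu>. h \<in> carrier F \<Longrightarrow> a \<in> letters \<Longrightarrow> \<nu> \<in> M \<Longrightarrow> G (h \<otimes>\<^bsub>F\<^esub> \<nu>) a = G h a"
      "\<And>h a. h \<in> carrier F \<Longrightarrow> a \<in> letters \<Longrightarrow>
        (\<Sum>b\<in>letters - {inv_letter a}. G (push_letter b h) b) + of_bool (on_axis x M h) \<le> \<beta> * G h a"
    using ctl unfolding controlled_def by blast
  have xl: "(x, True) \<in> letters" using x by (simp add: letters_def)
  have C: "C \<ge> 0" using G(1)[OF F.one_closed xl] G(2)[OF F.one_closed xl] by linarith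
  define z where "z = 1 / sqrt \<beta>"
  have s1: "sqrt \<beta> > 1" using \<beta> by simp
  then have z: "0 < z" "z < 1" by (simp_all add: z_def)
  have \<beta>z: "\<beta> * z\<^sup>2 = 1" using \<beta> by (simp add: z_def power_divide)
  define \<mu> where "\<mu> = (sqrt \<beta> + \<rho>) / 2"
  have \<mu>: "sqrt \<beta> < \<mu>" "\<mu> < \<rho>" using \<beta> by (simp_all add: \<mu>_def)
  define t where "t = \<mu> / sqrt \<beta> - 1"
  have t: "t > 0" using \<mu> s1 by (simp add: t_def)
  \<comment> \<open>This gives \<open>\<delta> * C < t\<close>, where
    \<open>(1 + t) * sqrt \<beta> = \<mu>\<close>; the 1 in \<open>C + 1\<close> allows for C =
    0.\<close>
  define \<delta> where "\<delta> = t / (2 * (C + 1))"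
  have \<delta>: "\<delta> > 0" using t C by (simp add: \<delta>_def)
  have "\<delta> * C = t * (C / (2 * (C + 1)))" by (simp add: \<delta>_def)
  also have "\<dots> < t * 1" using t C by (intro mult_strict_left_mono) auto
  finally have "(1 + \<delta> * C) * sqrt \<beta> < (1 + t) * sqrt \<beta>" using s1 by simp
  also have "(1 + t) * sqrt \<beta> = \<mu>" using s1 by (simp add: t_def)
  finally have \<delta>C: "(1 + \<delta> * C) * sqrt \<beta> < \<mu>" .
  have zn: "(\<lambda>n. z ^ n) \<longlonglongrightarrow> 0" using z by (intro LIMSEQ_realpow_zero) auto
  have "(\<lambda>n. (1 + \<delta> * C) * ((1 + z ^ n) / z)) \<longlonglongrightarrow> (1 + \<delta> * C) * ((1 + 0) / z)"
    using z by (intro tendsto_intros zn) auto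
  moreover have "(1 + \<delta> * C) * ((1 + 0) / z) < \<mu>" using \<delta>C by (simp add: z_def)
  ultimately have e1: "\<forall>\<^sub>F n in sequentially. (1 + \<delta> * C) * ((1 + z ^ n) / z) < \<mu>" by (rule order_tendstoD)
  have "(\<lambda>n. (1 + \<delta> * C) * (2 * z ^ n)) \<longlonglongrightarrow> (1 + \<delta> * C) * (2 * 0)"
    by (intro tendsto_intros zn)
  \<comment> \<open>One factor z is spent later on replacing \<open>z ^ R\<close> by
    \<open>z ^ (R - 1)\<close>.\<close>
  moreover have "(1 + \<delta> * C) * (2 * 0) < \<delta> * z * z" using \<delta> z by simp
  ultimately have e2: "\<forall>\<^sub>F n in sequentially. (1 + \<delta> * C) * (2 * z ^ n) < \<delta> * z * z" by (rule order_tendstoD)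
  from eventually_conj[OF e1 e2] obtain n0 where n0: "\<And>n. n \<ge> n0 \<Longrightarrow>
      (1 + \<delta> * C) * ((1 + z ^ n) / z) < \<mu> \<and> (1 + \<delta> * C) * (2 * z ^ n) < \<delta> * z * z"
    by (auto simp: eventually_sequentially)
  define R where "R = R0 * Suc n0"
  have Rge: "R \<ge> 1" "R \<ge> n0" using R0 mult_le_mono1[of 1 R0 "Suc n0"] by (auto simp: R_def)
  have xR: "(push_letter (x, True) ^^ R) [] \<in> M"
    unfolding R_def by (rule push_pow_mult_mem[OF xl M R0(2)])
  have "cycle_cover X x M R"
    by (intro cycle_cover.intro cycle_cover_axioms.intro finite_basis_axioms x M Rge(1) xR)
  then interpret weighted_cycle_cover X x M R z
    by (intro weighted_cycle_cover.intro weighted_cycle_cover_axioms.intro z)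
  have "z ^ R = z * z ^ (R - 1)" using Rge by (simp flip: power_Suc)
  then have "(1 + \<delta> * C) * (2 * z ^ (R - 1)) * z < \<delta> * z * z"
    using n0[OF Rge(2)] by (simp add: mult_ac)
  then have "(1 + \<delta> * C) * (2 * z ^ (R - 1)) \<le> \<delta> * z" using z by simp
  then have "controlled x kernel \<rho>"
    using n0[OF Rge(2)] by (intro controlled_kernel[OF \<beta>z \<delta> \<mu>(2) G]) auto
  then show ?thesis using Rge(1) pos_pow_kernel kernel_normal by blast
qed

text \<open>The induction carries a power of x in \<open>N\<close> along, because the next cactus is
  built from it. The threshold for l is the square of that for \<open>Suc l\<close>, so a \<beta>
  strictly between \<open>r\<^sup>2\<close> and \<open>\<rho>\<^sup>2\<close> serves for the
  previous term.\<close>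

lemma ex_subnormal_controlled:
  assumes X: "card X \<ge> 2" and x: "x \<in> X" and gt: "\<rho> > (2 * real (card X) - 1) powr (2 powr (- real l))"
  shows "\<exists>N R. R \<ge> 1 \<and> (push_letter (x, True) ^^ R) [] \<in> N \<and> subgroup N F \<and> l_subnormal l N F \<and> controlled x N \<rho>"
  using gt
proof (induction l arbitrary: \<rho>)
  case 0
  have "X \<noteq> {}" using x by auto
  moreover have "\<rho> > 2 * real (card X) - 1" using 0 X by simp
  moreover have "[(x, True)] \<in> carrier F" using x by (intro letter_closed) (simp add: letters_def)
  ultimately show ?case
    using controlled_carrier[of \<rho> x] F.subgroup_self
    by (intro exI[of _ "carrier F"] exI[of _ 1]) (auto simp: l_subnormal_def)
next
  case (Suc l)
  let ?q = "2 * real (card X) - 1"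
  define r where "r = ?q powr (2 powr (- real (Suc l)))"
  have q: "?q > 1" using X by simp
  have r1: "r > 1" unfolding r_def using q by (intro gr_one_powr) auto
  have "r\<^sup>2 = ?q powr (2 powr (- real (Suc l)) * 2)"
    using q by (simp add: r_def powr_power mult.commute)
  also have "2 powr (- real (Suc l)) * 2 = 2 powr (- real l)"
    by (simp add: powr_diff powr_minus field_simps powr_add)
  finally have r2: "r\<^sup>2 = ?q powr (2 powr (- real l))" .
  have "r < \<rho>" using Suc.prems by (simp add: r_def)
  then have lt: "r\<^sup>2 < \<rho>\<^sup>2" using r1 by (intro power_strict_mono) auto
  define \<beta> where "\<beta> = (r\<^sup>2 + \<rho>\<^sup>2) / 2"
  have \<beta>: "r\<^sup>2 < \<beta>" "\<beta> < \<rho>\<^sup>2" using lt by (simp_all add: \<beta>_def)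
  have "1 < r\<^sup>2" using r1 by simp
  then have "\<beta> > 1" using \<beta> by linarith
  have "sqrt \<beta> < \<rho>" using \<beta> \<open>r < \<rho>\<close> r1 by (intro real_less_lsqrt) auto
  obtain M R where M: "R \<ge> 1" "(push_letter (x, True) ^^ R) [] \<in> M" "subgroup M F" "l_subnormal l M F" "controlled x M \<beta>"
    using Suc.IH[of \<beta>] \<beta>(1) r2 by auto
  obtain N R' where N: "R' \<ge> 1" "(push_letter (x, True) ^^ R') [] \<in> N" "N \<lhd> F\<lparr>carrier := M\<rparr>" "controlled x N \<rho>"
    using ex_controlled_normal[OF x M(3,1,2,5) \<open>\<beta> > 1\<close> \<open>sqrt \<beta> < \<rho>\<close>] by blast
  have sN: "subgroup N F" using N(3) normal_restrict_iff[OF M(3)] by blast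
  obtain S where S: "S 0 = carrier F" "S l = M" "\<forall>i<l. S (Suc i) \<lhd> F\<lparr>carrier := S i\<rparr>"
    using M(4) unfolding l_subnormal_def by blast
  have "l_subnormal (Suc l) N F"
    unfolding l_subnormal_def
    by (rule exI[of _ "S(Suc l := N)"]) (use S N(3) in \<open>auto simp: less_Suc_eq\<close>)
  with N sN show ?case by blast
qed

theorem ex_subnormal_growth_rate_lt:
  assumes X: "card X \<ge> 2" and \<epsilon>: "\<epsilon> > 0"
  shows "\<exists>N. l_subnormal l N F \<and> N \<noteq> {\<one>\<^bsub>F\<^esub>} \<and>
    growth_rate N < (2 * real (card X) - 1) powr (2 powr (- real l)) + \<epsilon>"
proof -
  have X0: "X \<noteq> {}" using X by auto
  then obtain x where x: "x \<in> X" by auto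
  let ?r = "(2 * real (card X) - 1) powr (2 powr (- real l))"
  have r: "?r \<ge> 1" using X by (intro ge_one_powr_ge_zero) auto
  \<comment> \<open>Control bounds the growth rate weakly; the other half of \<epsilon> makes the
    final inequality strict.\<close>
  have "?r + \<epsilon> / 2 > ?r" using \<epsilon> by simp
  from ex_subnormal_controlled[OF X x this] obtain N R where
    N: "R \<ge> 1" "(push_letter (x, True) ^^ R) [] \<in> N" "subgroup N F" "l_subnormal l N F" "controlled x N (?r + \<epsilon> / 2)"
    by blast
  have nt: "N \<noteq> {\<one>\<^bsub>F\<^esub>}" using N(1,2) by (auto simp: push_pow_Nil)
  have pos: "?r + \<epsilon> / 2 \<ge> 1" using r \<epsilon> by simp
  obtain K where "K > 0" "\<And>n. real (card {g \<in> N. length g = n}) \<le> K * (?r + \<epsilon> / 2) ^ n"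
    using controlled_sphere_le[OF subgroup.subset[OF N(3)] N(5)] pos by auto
  from growth_rate_le[OF X0 N(3) subnormal_full[OF X N(4) nt] this(1) pos this(2)]
  have "growth_rate N \<le> ?r + \<epsilon> / 2" .
  then show ?thesis using N(4) nt \<epsilon> by (intro exI[of _ N]) auto
qed

end

theorem theorem1p8:
  fixes X :: "'a set" and m l :: nat
  assumes "m \<ge> 2" and "l \<ge> 1" and "finite X" and "card X = m"
  shows "(\<forall>N. l_subnormal l N (free_group X) \<and> N \<noteq> {\<one>\<^bsub>free_group X\<^esub>} \<longrightarrow>
            growth_rate N > (2 * real m - 1) powr (2 powr (- real l))) \<and>
         (\<forall>\<epsilon>::real. \<epsilon> > 0 \<longrightarrow>
            (\<exists>N. l_subnormal l N (free_group X) \<and> N \<noteq> {\<one>\<^bsub>free_group X\<^esub>} \<and>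
                 growth_rate N < (2 * real m - 1) powr (2 powr (- real l)) + \<epsilon>))"
proof -
  interpret finite_basis X by unfold_locales (rule assms(3))
  show ?thesis
    using growth_rate_subnormal_gt[of l] ex_subnormal_growth_rate_lt[of _ l] assms(1,2,4) by blast
qed

end
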